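(* The function $\mathbf{P}(z)$ defined by $$\mathbf{P}(z):=\sum_{0<n\equiv1\,(24)}p_1^+(n)\,q^{\frac{n}{24}}-\sum_{-1\le n\equiv23\,(24)}p\!\left(\tfrac{n+1}{24}\right)n^{\frac32}\,\beta(ny)\,q^{-\frac{n}{24}}$$ is a weak harmonic Maass form of weight $\tfrac52$ on $\mathrm{SL}_2(\mathbb{Z})$ with multiplier $\varepsilon$, i.e. $\mathbf{P}\in H^!_{5/2}(\varepsilon)$.
   Context: Write $z=x+iy\in\mathbb{H}$, $q=e^{2\pi i z}$, $q^{r}=e^{2\pi i r z}$ for $r\in\mathbb{Q}$; powers $\tau^k$ use the principal branch ($\arg\tau\in(-\pi,\pi]$), so e.g. $(-1)^{3/2}=-i$. $p(n)$ is the ordinary partition function, $p(0)=1$. The eta function $\eta(z)=q^{1/24}\prod_{n\ge1}(1-q^n)$ satisfies $\eta(\gamma z)=\varepsilon(\gamma)(cz+d)^{1/2}\eta(z)$ for $\gamma=\begin{pmatrix}a&b\\c&d\end{pmatrix}\in \mathrm{SL}_2(\mathbb{Z})$, which defines the multiplier system $\varepsilon$. For $k=5/2$, $H_k^!(\varepsilon)$ (weak harmonic Maass forms) is the complex vector space of real analytic $f:\mathbb{H}\to\mathbb{C}$ such that $f(\gamma z)=\varepsilon(\gamma)(cz+d)^kf(z)$ for all $\gamma\in\mathrm{SL}_2(\mathbb{Z})$, $\Delta_kf=0$ where $\Delta_k=-y^2\left(\frac{\partial^2}{\partial x^2}+\frac{\partial^2}{\partial y^2}\right)+iky\left(\frac{\partial}{\partial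 x}+i\frac{\partial}{\partial y}\right)$, and such that in the Fourier expansion $$f(z)=\sum_{n\equiv1\,(24)}a^+(n)q^{n/24}+\sum_{n\equiv-1\,(24)}a^-(n)\,\Gamma\!\left(1-k,\tfrac{\pi ny}{6}\right)q^{-n/24}$$ only finitely many $a^{\pm}(n)$ with $n\le0$ are nonzero. $\beta(y)=\Gamma\!\left(-\tfrac32,\tfrac{\pi y}{6}\right)$, where $\Gamma(s,y)=\int_y^\infty e^{-t}t^{s-1}dt$; for negative real $y$ the principal branch is used ($\arg y=\pi$, path of integration through the upper half plane). The numbers $p_1^+(n)$ are defined as follows: there is a unique $h_1\in H^!_{5/2}(\varepsilon)$ with Fourier expansion of the form $$h_1(z)=\sum_{0<n\equiv1\,(24)}p_1^+(n)q^{n/24}+i\beta(-y)q^{1/24}+\sum_{0<n\equiv-1\,(24)}p_1^-(n)\beta(ny)q^{-n/24},$$ and $p_1^+(n)$ are the coefficients of its holomorphic part. *)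

theory Defs
  imports "HOL-Complex_Analysis.Complex_Analysis" "HOL-Number_Theory.Cong" "HOL-Library.Multiset"
begin

definition upper_half :: "complex set" where
  "upper_half = {z. Im z > 0}"

definition q_pow :: "real \<Rightarrow> complex \<Rightarrow> complex" where
  "q_pow r z = exp (2 * of_real pi * \<i> * of_real r * z)"

definition dedekind_eta :: "complex \<Rightarrow> complex" where
  "dedekind_eta z = q_pow (1 / 24) z * (\<Prod>n. 1 - q_pow (real (Suc n)) z)"

definition SL2Z :: "(int^2^2) set" where
  "SL2Z = {\<gamma>. det \<gamma> = 1}"

definition aut_factor :: "int^2^2 \<Rightarrow> complex \<Rightarrow> complex" where
  "aut_factor \<gamma> z = of_int (\<gamma>$2$1) * z + of_int (\<gamma>$2$2)"

definition moebius :: "int^2^2 \<Rightarrow> complex \<Rightarrow> complex" where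
  "moebius \<gamma> z = (of_int (\<gamma>$1$1) * z + of_int (\<gamma>$1$2)) / aut_factor \<gamma> z"

definition eta_multiplier :: "int^2^2 \<Rightarrow> complex" where
  "eta_multiplier \<gamma> = (THE e. \<forall>z\<in>upper_half.
     dedekind_eta (moebius \<gamma> z) = e * aut_factor \<gamma> z powr (1 / 2) * dedekind_eta z)"

text \<open>
  The incomplete Gamma function $\Gamma(s,y)$ for real $y \neq 0$. If $y < 0$, the path from $y$
  to $+\infty$ is the half circle from $y$ to $|y|$ in the upper half plane, followed by the ray
  from $|y|$. On this half circle the principal power is continuous, with argument $\pi$ at $y$.
\<close>

definition inc_Gamma :: "real \<Rightarrow> real \<Rightarrow> complex" where
  "inc_Gamma s y =
     (if y < 0
      then contour_integral (part_circlepath 0 \<bar>y\<bar> pi 0) (\<lambda>t. exp (- t) * t powr of_real (s - 1))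
      else 0)
     + of_real (integral {\<bar>y\<bar>..} (\<lambda>t::real. exp (- t) * t powr (s - 1)))"

definition \<beta> :: "real \<Rightarrow> complex" where
  "\<beta> y = inc_Gamma (- 3 / 2) (pi * y / 6)"

text \<open>
  Functions on the upper half plane are represented by functions on all of \<^typ>\<open>complex\<close>; none of
  the following notions depends on the values outside \<^const>\<open>upper_half\<close>.
  Real analytic means: locally a convergent double power series in the real and imaginary parts.
\<close>

definition real_analytic :: "(complex \<Rightarrow> complex) \<Rightarrow> bool" where
  "real_analytic f \<longleftrightarrow> (\<forall>z\<in>upper_half. \<exists>r>0. \<exists>c :: nat \<Rightarrow> nat \<Rightarrow> complex.
     \<forall>u v :: real. \<bar>u\<bar> < r \<and> \<bar>v\<bar> < r \<longrightarrow>
       ((\<lambda>(l, m). c l m * of_real u ^ l * of_real v ^ m) has_sum f (z + Complex u v)) UNIV)"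

definition partial_x :: "(complex \<Rightarrow> complex) \<Rightarrow> complex \<Rightarrow> complex" where
  "partial_x f z = vector_derivative (\<lambda>t::real. f (z + of_real t)) (at 0)"

definition partial_y :: "(complex \<Rightarrow> complex) \<Rightarrow> complex \<Rightarrow> complex" where
  "partial_y f z = vector_derivative (\<lambda>t::real. f (z + \<i> * of_real t)) (at 0)"

definition laplacian :: "real \<Rightarrow> (complex \<Rightarrow> complex) \<Rightarrow> complex \<Rightarrow> complex" where
  "laplacian k f z =
     - of_real ((Im z)\<^sup>2) * (partial_x (partial_x f) z + partial_y (partial_y f) z)
     + \<i> * of_real (k * Im z) * (partial_x f z + \<i> * partial_y f z)"

definition has_maass_expansion ::
    "real \<Rightarrow> (complex \<Rightarrow> complex) \<Rightarrow> (int \<Rightarrow> complex) \<Rightarrow> (int \<Rightarrow> complex) \<Rightarrow> bool" where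
  "has_maass_expansion k f a_plus a_minus \<longleftrightarrow> (\<forall>z\<in>upper_half. \<exists>S T.
     ((\<lambda>n. a_plus n * q_pow (of_int n / 24) z) has_sum S) {n. [n = 1] (mod 24)} \<and>
     ((\<lambda>n. a_minus n * inc_Gamma (1 - k) (pi * of_int n * Im z / 6) * q_pow (- of_int n / 24) z)
        has_sum T) {n. [n = -1] (mod 24)} \<and>
     f z = S + T)"

text \<open>
  The residue classes in the expansion are those forced by the behaviour of the multiplier
  system under $z \mapsto z + 1$, for the weight $k = 5/2$ used here.
\<close>

definition weak_harmonic_maass :: "real \<Rightarrow> (complex \<Rightarrow> complex) set" where
  "weak_harmonic_maass k = {f.
     real_analytic f \<and>
     (\<forall>\<gamma>\<in>SL2Z. \<forall>z\<in>upper_half.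
        f (moebius \<gamma> z) = eta_multiplier \<gamma> * aut_factor \<gamma> z powr of_real k * f z) \<and>
     (\<forall>z\<in>upper_half. laplacian k f z = 0) \<and>
     (\<exists>a_plus a_minus. has_maass_expansion k f a_plus a_minus \<and>
        finite {n. n \<le> 0 \<and> [n = 1] (mod 24) \<and> a_plus n \<noteq> 0} \<and>
        finite {n. n \<le> 0 \<and> [n = -1] (mod 24) \<and> a_minus n \<noteq> 0})}"

definition partition_number :: "nat \<Rightarrow> nat" where
  "partition_number n = card {M :: nat multiset. 0 \<notin># M \<and> \<Sum>\<^sub># M = n}"

text \<open>
  The property that characterizes $h_1$ and its coefficients $p_1^+$ and $p_1^-$. The term
  $i\beta(-y)q^{1/24}$ is the one with index $n = -1$ in the nonholomorphic part.
\<close>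

definition is_h1 :: "(complex \<Rightarrow> complex) \<Rightarrow> (int \<Rightarrow> complex) \<Rightarrow> (int \<Rightarrow> complex) \<Rightarrow> bool" where
  "is_h1 h p_plus p_minus \<longleftrightarrow> h \<in> weak_harmonic_maass (5 / 2) \<and>
     (\<forall>z\<in>upper_half. \<exists>S T.
        ((\<lambda>n. p_plus n * q_pow (of_int n / 24) z) has_sum S) {n. 0 < n \<and> [n = 1] (mod 24)} \<and>
        ((\<lambda>n. p_minus n * \<beta> (of_int n * Im z) * q_pow (- of_int n / 24) z)
           has_sum T) {n. 0 < n \<and> [n = -1] (mod 24)} \<and>
        h z = S + \<i> * \<beta> (- Im z) * q_pow (1 / 24) z + T)"

text \<open>In the second sum, the power $n^{3/2}$ is principal; the term $n = -1$ has $(-1)^{3/2} = -i$.\<close>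

definition P_series :: "(int \<Rightarrow> complex) \<Rightarrow> complex \<Rightarrow> complex" where
  "P_series p_plus z =
     (\<Sum>\<^sub>\<infinity>n\<in>{n. 0 < n \<and> [n = 1] (mod 24)}. p_plus n * q_pow (of_int n / 24) z)
     - (\<Sum>\<^sub>\<infinity>n\<in>{n. -1 \<le> n \<and> [n = 23] (mod 24)}.
          of_nat (partition_number (nat ((n + 1) div 24))) * of_int n powr (3 / 2)
          * \<beta> (of_int n * Im z) * q_pow (- of_int n / 24) z)"

end

theory Submission
  imports Defs "HOL-Real_Asymp.Real_Asymp"
begin

text \<open>
  The coefficients \<open>p\<^sub>1\<^sup>-\<close> are identified through the derivative of \<open>h\<^sub>1\<close> with respect to
  \<open>cnj z\<close>. It equals \<open>y powr (-5/2) * cnj (g z)\<close> up to a constant, where \<open>g\<close> is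
  holomorphic with principal part \<open>q powr (-1/24)\<close> and inherits from \<open>h\<^sub>1\<close> weight \<open>-1/2\<close> with
  the conjugate multiplier. Hence \<open>g * \<eta>\<close> is invariant under \<open>z \<mapsto> -1/z\<close> and a holomorphic function
  of \<open>q\<close> on the whole unit disc, so it is constant, and \<open>g = 1/\<eta>\<close> is the generating function of
  the partition numbers. Therefore \<open>P\<close> coincides with \<open>h\<^sub>1\<close>. Only the inversion
  of \<open>SL\<^sub>2(\<int>)\<close> is needed, so the multiplier is computed for that matrix alone.
\<close>


subsection \<open>Partial fractions of the cotangent\<close>

text \<open>The coefficients \<open>p1_minus\<close> are given only through \<open>is_h1\<close>, so
  they must be recovered from the transformation law of \<open>h1\<close>. The derivative with
  respect to \<open>cnj z\<close> kills the holomorphic part and turns the n-th nonholomorphic term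
  into a multiple of n * n^(-5/2) = n^(-3/2) times the conjugate of q^(n/24); this is the origin of
  n^(3/2) in \<open>P_series\<close>. For n = -1 the principal powers give i = (-1)^(-3/2), and the
  coefficient i of that term in \<open>h1\<close> is what normalizes \<open>g\<close> to leading
  coefficient 1 = p(0). Two obstacles shape the rest. The expansion is only known to converge
  pointwise, so its coefficients must be bounded before it can be differentiated termwise. And
  \<open>eta_multiplier\<close> is a definite description, so its value at the inversion becomes
  available only with a proof of the inversion law of eta. That law comes from the logarithmic
  derivative of eta, an Eisenstein series of weight 2, whose failure to be modular produces the
  square root of z.\<close>

lemma Digamma_reflection:
  fixes z :: complex
  assumes "z \<notin> \<int>"
  shows "Digamma (1 - z) - Digamma z = of_real pi * cot (of_real pi * z)"
proof -
  have z1: "z \<notin> \<int>\<^sub>\<le>\<^sub>0"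
    using assms nonpos_Ints_Int by blast
  have z2: "1 - z \<notin> \<int>\<^sub>\<le>\<^sub>0"
    using assms by (metis Ints_1 Ints_diff diff_diff_eq2 add_diff_cancel_left' nonpos_Ints_Int)
  have s: "sin (of_real pi * z) \<noteq> 0"
    using assms rGamma_reflection_complex[of z] z1 z2 by (auto simp: rGamma_eq_zero_iff)
  \<comment> \<open>The reflection formula
    \<open>rGamma z * rGamma (1 - z) = sin (pi * z) / pi\<close> is differentiated on both sides;
    the derivative of \<open>rGamma\<close> is \<open>- rGamma * Digamma\<close> away from its
    zeros.\<close>
  have "((\<lambda>w. rGamma w * rGamma (1 - w)) has_field_derivative
          rGamma z * rGamma (1 - z) * (Digamma (1 - z) - Digamma z)) (at z)"
    using z1 z2 by (auto intro!: derivative_eq_intros simp: algebra_simps)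
  moreover have "((\<lambda>w. rGamma w * rGamma (1 - w)) has_field_derivative cos (of_real pi * z)) (at z)"
    unfolding rGamma_reflection_complex by (auto intro!: derivative_eq_intros)
  ultimately have "rGamma z * rGamma (1 - z) * (Digamma (1 - z) - Digamma z) = cos (of_real pi * z)"
    by (rule DERIV_unique)
  thus ?thesis
    using s by (simp add: rGamma_reflection_complex cot_def field_simps)
qed

text \<open>This is the derivative of \<open>Digamma_reflection\<close>. Its two terms are the
  halves over nonnegative and over negative integers of the sum of 1/(z+m)^2.\<close>

lemma Polygamma_1_reflection:
  fixes z :: complex
  assumes "z \<notin> \<int>"
  shows "Polygamma 1 z + Polygamma 1 (1 - z) = (of_real pi / sin (of_real pi * z))\<^sup>2"
proof -
  have z1: "z \<notin> \<int>\<^sub>\<le>\<^sub>0"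
    using assms nonpos_Ints_Int by blast
  have z2: "1 - z \<notin> \<int>\<^sub>\<le>\<^sub>0"
    using assms by (metis Ints_1 Ints_diff diff_diff_eq2 add_diff_cancel_left' nonpos_Ints_Int)
  have s: "sin (of_real pi * z) \<noteq> 0"
    using assms rGamma_reflection_complex[of z] z1 z2 by (auto simp: rGamma_eq_zero_iff)
  have "(Polygamma 0 has_field_derivative Polygamma (Suc 0) (1 - z)) (at (1 - z))"
    using z2 by (rule has_field_derivative_Polygamma)
  moreover have "((\<lambda>w. 1 - w) has_field_derivative (-1)) (at z)"
    by (auto intro!: derivative_eq_intros)
  ultimately have "((\<lambda>w. Digamma (1 - w)) has_field_derivative Polygamma 1 (1 - z) * (-1)) (at z)"
    by (intro DERIV_chain2) auto
  moreover have "(Digamma has_field_derivative Polygamma 1 z) (at z)"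
    using has_field_derivative_Polygamma[OF z1, of 0] by simp
  ultimately have "((\<lambda>w. Digamma (1 - w) - Digamma w) has_field_derivative
          Polygamma 1 (1 - z) * (-1) - Polygamma 1 z) (at z)"
    by (rule DERIV_diff)
  hence 1: "((\<lambda>w. of_real pi * cot (of_real pi * w)) has_field_derivative
          Polygamma 1 (1 - z) * (-1) - Polygamma 1 z) (at z)"
    by (rule has_field_derivative_transform_within_open[where S = "-\<int>"])
       (use assms in \<open>auto intro!: Digamma_reflection simp: open_Compl closed_Ints\<close>)
  have 2: "((\<lambda>w. of_real pi * cot (of_real pi * w)) has_field_derivative
          - (of_real pi / sin (of_real pi * z))\<^sup>2) (at z)"
  proof -
    have "((\<lambda>w. of_real pi * (cos (of_real pi * w) / sin (of_real pi * w))) has_field_derivative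
        of_real pi * ((- sin (of_real pi * z) * of_real pi * sin (of_real pi * z)
          - cos (of_real pi * z) * (cos (of_real pi * z) * of_real pi)) / (sin (of_real pi * z) * sin (of_real pi * z)))) (at z)"
      using s by (auto intro!: derivative_eq_intros simp: algebra_simps)
    also have "- sin (of_real pi * z) * of_real pi * sin (of_real pi * z)
          - cos (of_real pi * z) * (cos (of_real pi * z) * of_real pi)
        = - of_real pi * ((sin (of_real pi * z))\<^sup>2 + (cos (of_real pi * z))\<^sup>2)"
      unfolding power2_eq_square by (simp only: algebra_simps) simp
    finally show ?thesis
      by (simp add: cot_def power_divide flip: power2_eq_square)
  qed
  show ?thesis
    using DERIV_unique[OF 1 2] by (simp add: algebra_simps)
qed

lemma notin_Ints_if_Im:
  "Im z \<noteq> 0 \<Longrightarrow> z \<notin> \<int>"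
  by (auto simp: complex_is_Int_iff)

text \<open>With q = E^2 one has sin(pi w)^2 = -(1-q)^2/(4q), so the squared cosecant is a multiple
  of q/(1-q)^2, which is q times the derivative of the geometric series. This is the bridge from
  lattice sums to q-series.\<close>

lemma sums_csc_sq_exp:
  assumes "Im w > 0"
  shows "(\<lambda>k. of_nat (Suc k) * q_pow (of_nat (Suc k)) w) sums
           (- 1 / (4 * of_real pi ^ 2) * (of_real pi / sin (of_real pi * w))\<^sup>2)"
proof -
  define E where "E = exp (\<i> * of_real pi * w)"
  have nE: "norm (E\<^sup>2) < 1"
    using assms by (simp add: E_def norm_power power2_eq_square mult_pos_pos flip: exp_add)
  have Q: "q_pow (of_nat (Suc k)) w = E\<^sup>2 * (E\<^sup>2) ^ k" for k
    by (simp add: E_def q_pow_def algebra_simps flip: exp_of_nat_mult exp_double exp_add power_mult)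
  have E0: "E \<noteq> 0" by (simp add: E_def)
  have s: "sin (of_real pi * w) = (E - 1 / E) / (2 * \<i>)"
    by (simp add: sin_exp_eq E_def exp_minus field_simps)
  have "(\<lambda>k. E\<^sup>2 * (of_nat (Suc k) * (E\<^sup>2) ^ k)) sums (E\<^sup>2 * (1 / (1 - E\<^sup>2)\<^sup>2))"
    by (intro sums_mult geometric_deriv_sums nE)
  moreover have "E\<^sup>2 * (1 / (1 - E\<^sup>2)\<^sup>2) = - 1 / (4 * of_real pi ^ 2) * (of_real pi / sin (of_real pi * w))\<^sup>2"
  proof -
    have n1: "1 - E\<^sup>2 \<noteq> 0" "E\<^sup>2 - 1 \<noteq> 0" using nE by auto
    have "sin (of_real pi * w) = (E\<^sup>2 - 1) / (2 * \<i> * E)"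
      unfolding s using E0 by (simp add: field_simps power2_eq_square)
    hence "(of_real pi / sin (of_real pi * w))\<^sup>2 = of_real pi ^ 2 * (- 4 * E\<^sup>2) / (E\<^sup>2 - 1)\<^sup>2"
      by (simp add: power_divide power_mult_distrib)
    also have "(E\<^sup>2 - 1)\<^sup>2 = (1 - E\<^sup>2)\<^sup>2" by (simp add: power2_commute)
    finally have eq: "(of_real pi / sin (of_real pi * w))\<^sup>2 = of_real pi ^ 2 * (- 4 * E\<^sup>2) / (1 - E\<^sup>2)\<^sup>2" .
    show ?thesis unfolding eq by simp
  qed
  ultimately show ?thesis
    unfolding Q by (simp only: mult.assoc mult.left_commute)
qed

text \<open>The Digamma series at 1 + u is subtracted from the one at 1 - u; the shift
  \<open>Digamma (1 + u) = Digamma u + 1 / u\<close> accounts for the pole at 0.\<close>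

lemma cot_partial_fractions:
  fixes u :: complex
  assumes "u \<notin> \<int>"
  shows "(\<lambda>k. 2 * u / (u\<^sup>2 - of_nat (Suc k) ^ 2)) sums (of_real pi * cot (of_real pi * u) - 1 / u)"
proof -
  have *: "(\<lambda>n. inverse (of_nat (n+1)) - inverse (z + of_nat n)) sums (Digamma z + euler_mascheroni)"
    if "z \<noteq> 0" for z :: complex
    using summable_Digamma[OF that] by (simp add: Digamma_def summable_sums)
  have n0: "u \<noteq> 0" "1 - u \<noteq> 0" "1 + u \<noteq> 0"
    using assms by (auto simp: eq_neg_iff_add_eq_0 add.commute)
      (metis Ints_1 Ints_minus add.commute eq_neg_iff_add_eq_0)
  have nz: "u + of_nat (Suc n) \<noteq> 0" "u - of_nat (Suc n) \<noteq> 0" for n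
    using assms by (metis Ints_minus Ints_of_nat eq_neg_iff_add_eq_0, metis Ints_of_nat eq_iff_diff_eq_0)
  have "(\<lambda>n. (inverse (of_nat (n+1)) - inverse (1 - u + of_nat n)) - (inverse (of_nat (n+1)) - inverse (1 + u + of_nat n)))
     sums (Digamma (1 - u) + euler_mascheroni - (Digamma (1 + u) + euler_mascheroni))"
    using n0 by (intro sums_diff *) auto
  moreover have "Digamma (1 + u) = Digamma u + 1 / u"
    using Digamma_plus1[OF n0(1)] by (simp add: add.commute)
  moreover have "(inverse (of_nat (n+1)) - inverse (1 - u + of_nat n)) - (inverse (of_nat (n+1)) - inverse (1 + u + of_nat n))
      = 2 * u / (u\<^sup>2 - of_nat (Suc n) ^ 2)" for n
  proof -
    have e: "u\<^sup>2 - of_nat (Suc n) ^ 2 = (u + of_nat (Suc n)) * (u - of_nat (Suc n))"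
      by (simp add: power2_eq_square algebra_simps)
    have e2: "1 - u + of_nat n = - (u - of_nat (Suc n))" "1 + u + of_nat n = u + of_nat (Suc n)" by auto
    show ?thesis unfolding e e2 inverse_minus_eq
      using nz[of n] by (simp add: divide_simps) (simp add: algebra_simps)
  qed
  ultimately show ?thesis
    using Digamma_reflection[OF assms] by (simp add: algebra_simps)
qed

text \<open>In terms of E = exp(-2 pi i u), which tends to 0 here, cot is i(1+E)/(1-E). The nonzero
  limit is what makes the two orders of summation in \<open>sums_csc_sq_inversion\<close>
  disagree.\<close>

lemma tendsto_cot_lower:
  assumes "filterlim (\<lambda>x. Im (u x)) at_bot F"
  shows "((\<lambda>x. cot (of_real pi * u x)) \<longlongrightarrow> \<i>) F"
proof -
  define E where "E = (\<lambda>x. exp (- 2 * \<i> * of_real pi * u x))"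
  have "filterlim (\<lambda>x. 2 * pi * Im (u x)) at_bot F"
    by (rule filterlim_tendsto_pos_mult_at_bot[OF tendsto_const _ assms]) auto
  hence "((\<lambda>x. norm (E x)) \<longlongrightarrow> 0) F"
    unfolding E_def by (auto intro!: filterlim_compose[OF exp_at_bot])
  hence "(E \<longlongrightarrow> 0) F" by (simp add: tendsto_norm_zero_iff)
  hence "((\<lambda>x. \<i> * (1 + E x) / (1 - E x)) \<longlongrightarrow> \<i> * (1 + 0) / (1 - 0)) F"
    by (intro tendsto_intros) auto
  moreover have "\<i> * (1 + E x) / (1 - E x) = cot (of_real pi * u x)" for x
  proof -
    define a where "a = exp (\<i> * (of_real pi * u x))"
    have a0: "a \<noteq> 0" by (simp add: a_def)
    have e: "E x = 1 / a^2"
      unfolding E_def a_def by (simp add: exp_minus divide_inverse flip: exp_double exp_of_nat_mult) (simp add: mult_ac exp_minus)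
    have c: "cos (of_real pi * u x) = (a\<^sup>2 + 1) / (2 * a)" "sin (of_real pi * u x) = (a\<^sup>2 - 1) / (2 * \<i> * a)"
      using a0 by (simp_all add: cos_exp_eq sin_exp_eq exp_minus power2_eq_square field_simps flip: a_def)
    have "\<i> * (1 + E x) / (1 - E x) = \<i> * ((a\<^sup>2 + 1) / a\<^sup>2) / ((a\<^sup>2 - 1) / a\<^sup>2)"
      using a0 by (simp add: e add_divide_distrib diff_divide_distrib add.commute)
    also have "\<dots> = cot (of_real pi * u x)"
      unfolding cot_def c using a0 by simp
    finally show ?thesis .
  qed
  ultimately show ?thesis by simp
qed

text \<open>The two summands are the series of \<open>Polygamma 1\<close> at 1 + w and at 1 - w;
  \<open>1 / w\<^sup>2\<close> is the missing term of index 0.\<close>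

lemma sums_csc_sq:
  fixes w :: complex
  assumes "w \<notin> \<int>"
  shows "(\<lambda>k. 1 / (w + of_nat (Suc k))\<^sup>2 + 1 / (w - of_nat (Suc k))\<^sup>2) sums
           ((of_real pi / sin (of_real pi * w))\<^sup>2 - 1 / w\<^sup>2)"
proof -
  have n0: "w \<noteq> 0" "1 - w \<noteq> 0" "1 + w \<noteq> 0"
    using assms by (auto simp: eq_neg_iff_add_eq_0 add.commute)
      (metis Ints_1 Ints_minus add.commute eq_neg_iff_add_eq_0)
  have *: "(\<lambda>k. 1 / (z + of_nat k)\<^sup>2) sums Polygamma 1 z" if "z \<noteq> 0" for z :: complex
    using Polygamma_LIMSEQ[OF that, of 1] by (simp add: inverse_eq_divide power2_eq_square)
  have "(\<lambda>k. 1 / (1 + w + of_nat k)\<^sup>2 + 1 / (1 - w + of_nat k)\<^sup>2) sums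
          (Polygamma 1 (1 + w) + Polygamma 1 (1 - w))"
    using n0 by (intro sums_add *)
  moreover have "Polygamma 1 (1 + w) = Polygamma 1 w - 1 / w\<^sup>2"
    using Polygamma_plus1[OF n0(1), of 1] by (simp add: add.commute power2_eq_square)
  moreover have "(1 - w + of_nat k)\<^sup>2 = (w - of_nat (Suc k))\<^sup>2" for k
    by (subst power2_commute) (simp add: algebra_simps)
  moreover have "1 + w + of_nat k = w + of_nat (Suc k)" for k
    by (simp add: algebra_simps)
  ultimately have "(\<lambda>k. 1 / (w + of_nat (Suc k))\<^sup>2 + 1 / (w - of_nat (Suc k))\<^sup>2) sums
          (Polygamma 1 w - 1 / w\<^sup>2 + Polygamma 1 (1 - w))"
    by simp
  also have "Polygamma 1 w - 1 / w\<^sup>2 + Polygamma 1 (1 - w) = (of_real pi / sin (of_real pi * w))\<^sup>2 - 1 / w\<^sup>2"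
    by (simp flip: Polygamma_1_reflection[OF assms])
  finally show ?thesis .
qed

subsection \<open>The lattice sum behind the eta function\<close>

text \<open>The norm dominates both n * Im z and, by the triangle inequality, a multiple of
  \<bar>x\<bar>; the product of the two bounds is taken. A bound by n * \<bar>x\<bar> makes fourth
  inverse powers of lattice points summable as a product of two single series.\<close>

lemma lattice_norm_ge:
  fixes z :: complex
  assumes "Im z > 0"
  obtains c where "c > 0" "\<And>n x :: real. n \<ge> 0 \<Longrightarrow> c * n * \<bar>x\<bar> \<le> (norm (of_real n * z + of_real x))\<^sup>2"
proof
  define y where "y = Im z"
  have y: "y > 0" using assms by (simp add: y_def)
  let ?c = "y * y / (y + norm z)"
  have p: "y + norm z > 0" using y by (simp add: add_pos_nonneg)
  show "?c > 0" using y p by simp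
  fix n x :: real assume n: "n \<ge> 0"
  let ?N = "norm (of_real n * z + of_real x)"
  have 1: "n * y \<le> ?N"
    using abs_Im_le_cmod[of "of_real n * z + of_real x"] n y by (simp add: y_def)
  have "\<bar>x\<bar> = norm (of_real n * z + of_real x - of_real n * z)"
    by simp
  also have "\<dots> \<le> ?N + norm (of_real n * z)" by (rule norm_triangle_ineq4)
  also have "\<dots> = ?N + n * norm z" using n by (simp add: norm_mult)
  finally have "\<bar>x\<bar> * y \<le> (?N + n * norm z) * y"
    using y by (intro mult_right_mono) auto
  also have "\<dots> = ?N * y + n * y * norm z" by (simp add: algebra_simps)
  also have "\<dots> \<le> ?N * y + ?N * norm z"
    using 1 by (intro add_left_mono mult_right_mono) auto
  finally have 2: "\<bar>x\<bar> * y \<le> ?N * (y + norm z)" by (simp add: algebra_simps)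
  have "(n * y) * (\<bar>x\<bar> * y) \<le> ?N * (?N * (y + norm z))"
    using n y by (intro mult_mono[OF 1 2]) auto
  thus "?c * n * \<bar>x\<bar> \<le> ?N\<^sup>2"
    using p by (simp add: pos_divide_le_eq power2_eq_square mult_ac)
qed

text \<open>The difference of reciprocals is 1/(w^2 - 1/4), so subtracting it from 1/w^2 leaves a
  quantity of order w^(-4).\<close>

lemma telescoped_square_bound:
  fixes w :: complex
  assumes "t > 0" "(norm w)\<^sup>2 \<ge> t" "(norm (w - 1/2))\<^sup>2 \<ge> t" "(norm (w + 1/2))\<^sup>2 \<ge> t"
  shows "norm (1 / w\<^sup>2 - (1 / (w - 1/2) - 1 / (w + 1/2))) \<le> 1 / t\<^sup>2"
proof -
  have n0: "w \<noteq> 0" "w - 1/2 \<noteq> 0" "w + 1/2 \<noteq> 0"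
    using assms by (metis leD norm_zero power_zero_numeral)+
  have "1 / (w - 1/2) - 1 / (w + 1/2) = 1 / ((w - 1/2) * (w + 1/2))"
    using n0(2,3) by (simp add: diff_frac_eq)
  moreover have "1 / w\<^sup>2 - 1 / ((w - 1/2) * (w + 1/2)) = ((w - 1/2) * (w + 1/2) - w\<^sup>2) / (w\<^sup>2 * ((w - 1/2) * (w + 1/2)))"
    using n0 by (subst diff_frac_eq) auto
  moreover have "(w - 1/2) * (w + 1/2) - w\<^sup>2 = - 1/4"
    by (simp add: algebra_simps power2_eq_square)
  ultimately have "norm (1 / w\<^sup>2 - (1 / (w - 1/2) - 1 / (w + 1/2)))
      = (1/4) / ((norm w)\<^sup>2 * (norm (w - 1/2) * norm (w + 1/2)))"
    by (simp add: norm_divide norm_mult norm_power)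
  also have "\<dots> \<le> (1/4) / (t * t)"
  proof (intro divide_left_mono mult_mono)
    have "t * t \<le> (norm (w - 1/2))\<^sup>2 * (norm (w + 1/2))\<^sup>2"
      using assms by (intro mult_mono) auto
    hence "t\<^sup>2 \<le> (norm (w - 1/2) * norm (w + 1/2))\<^sup>2"
      by (simp add: power2_eq_square mult_ac)
    thus "t \<le> norm (w - 1/2) * norm (w + 1/2)"
      by (rule power2_le_imp_le) simp
  qed (use assms n0 in \<open>auto intro!: mult_pos_pos\<close>)
  also have "\<dots> \<le> 1 / t\<^sup>2" using assms(1) by (simp add: power2_eq_square field_simps)
  finally show ?thesis .
qed

lemma summable_on_product_nonneg:
  fixes f g :: "nat \<Rightarrow> real"
  assumes "summable f" "summable g" "\<And>n. f n \<ge> 0" "\<And>n. g n \<ge> 0"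
  shows "(\<lambda>(m, n). f m * g n) summable_on UNIV \<times> UNIV"
proof (rule summable_on_SigmaI)
  have f: "(f has_sum suminf f) UNIV" and g: "(g has_sum suminf g) UNIV"
    using assms by (auto intro!: sums_nonneg_imp_has_sum summable_sums)
  show "((\<lambda>n. (\<lambda>(m, n). f m * g n) (m, n)) has_sum (f m * suminf g)) UNIV" for m
    using has_sum_cmult_right[OF g, of "f m"] by simp
  show "(\<lambda>m. f m * suminf g) summable_on UNIV"
    using has_sum_cmult_left[OF f, of "suminf g"] unfolding summable_on_def by blast
qed (use assms in auto)

lemma suminf_sums_swap:
  fixes f :: "nat \<Rightarrow> nat \<Rightarrow> complex"
  assumes "(\<lambda>(m, n). f m n) summable_on UNIV \<times> UNIV"
  obtains D where "(\<lambda>m. suminf (f m)) sums D" "(\<lambda>n. suminf (\<lambda>m. f m n)) sums D"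
proof -
  have outer: "(\<lambda>m. suminf (g m)) sums D"
    if "((\<lambda>(m, n). g m n) has_sum D) (UNIV \<times> UNIV)" for g :: "nat \<Rightarrow> nat \<Rightarrow> complex" and D
  proof (rule has_sum_imp_sums, rule has_sum_SigmaD[OF that])
    fix m
    have "g m summable_on UNIV"
      using that summable_on_SigmaD1[of g UNIV "\<lambda>_. UNIV" m] by (auto simp: summable_on_def)
    then obtain s where "(g m has_sum s) UNIV" by (auto simp: summable_on_def)
    moreover from this have "suminf (g m) = s"
      using has_sum_imp_sums sums_unique by fastforce
    ultimately show "((\<lambda>n. (\<lambda>(m, n). g m n) (m, n)) has_sum suminf (g m)) UNIV" by simp
  qed
  obtain D where D: "((\<lambda>(m, n). f m n) has_sum D) (UNIV \<times> UNIV)"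
    using assms by (auto simp: summable_on_def)
  moreover from this have "((\<lambda>(n, m). f m n) has_sum D) (UNIV \<times> UNIV)"
    by (subst has_sum_swap) (simp add: case_prod_unfold)
  ultimately show ?thesis
    using outer[of f D] outer[of "\<lambda>n m. f m n" D] that by blast
qed

text \<open>
  The sums of \<open>1/(nz+m)\<^sup>2\<close> by rows and by columns differ, because the
  double series converges only conditionally. Subtracting
  \<open>1/((nz+m)\<^sup>2 - 1/4)\<close> makes it absolutely convergent, and the subtracted terms telescope in
  \<open>m\<close>; only the limit of \<open>cot\<close> at infinity survives.
\<close>

lemma sums_csc_sq_inversion:
  assumes z: "Im z > 0"
  obtains X where
    "(\<lambda>n. (of_real pi / sin (of_real pi * (of_nat (Suc n) * z)))\<^sup>2) sums
        (X + of_real pi ^ 2 / (6 * z\<^sup>2))"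
    "(\<lambda>n. (of_real pi / sin (of_real pi * (of_nat (Suc n) * (- 1 / z))))\<^sup>2 / z\<^sup>2) sums
        (X + of_real pi ^ 2 / 6 - \<i> * of_real pi / z)"
proof -
  have z0: "z \<noteq> 0" using z by auto
  have Imz': "Im (1 / z) < 0" using z by (simp add: Im_divide divide_neg_pos add_nonneg_pos)
  \<comment> \<open>Pairing m with -m makes each row a squared cosecant without its m = 0
    term.\<close>
  define a where "a = (\<lambda>m n. 1 / (of_nat (Suc n) * z + of_nat (Suc m))\<^sup>2 + 1 / (of_nat (Suc n) * z - of_nat (Suc m))\<^sup>2)"
  define e where "e = (\<lambda>v::complex. 1 / (v - 1/2) - 1 / (v + 1/2))"
  define b where "b = (\<lambda>m n. e (of_nat (Suc n) * z + of_nat (Suc m)) + e (of_nat (Suc n) * z - of_nat (Suc m)))"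
  \<comment> \<open>The sum over n of the telescoping boundary terms at \<mu>, in closed form by the
    partial fractions of cot at \<mu>/z.\<close>
  define T where "T = (\<lambda>\<mu>::real. (of_real pi * cot (of_real pi * (of_real \<mu> / z)) - 1 / (of_real \<mu> / z)) / z)"
  obtain c where c: "c > 0" "\<And>n x :: real. n \<ge> 0 \<Longrightarrow> c * n * \<bar>x\<bar> \<le> (norm (of_real n * z + of_real x))\<^sup>2"
    using lattice_norm_ge[OF z] by blast
  have bound: "norm (a m n - b m n) \<le> 8 / c\<^sup>2 * (1 / real (Suc m) ^ 2 * (1 / real (Suc n) ^ 2))" for m n
  proof -
    \<comment> \<open>The factor 1/2 lets one bound cover m + 1 and its neighbours at distance 1/2,
      since m + 1/2 is at least (m + 1)/2.\<close>
    define t where "t = c * real (Suc n) * (real (Suc m) / 2)"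
    have t: "t > 0" unfolding t_def using c(1) by (intro mult_pos_pos) auto
    have *: "t \<le> (norm (of_nat (Suc n) * z + of_real x))\<^sup>2" if "\<bar>x\<bar> \<ge> real (Suc m) / 2" for x
    proof -
      have "t \<le> c * real (Suc n) * \<bar>x\<bar>"
        unfolding t_def using that c(1) by (intro mult_left_mono) auto
      also have "\<dots> \<le> (norm (of_real (real (Suc n)) * z + of_real x))\<^sup>2"
        by (rule c(2)) auto
      finally show ?thesis by simp
    qed
    have 1: "norm (1 / (of_nat (Suc n) * z + of_nat (Suc m))\<^sup>2 - e (of_nat (Suc n) * z + of_nat (Suc m))) \<le> 1 / t\<^sup>2"
      unfolding e_def
      using *[of "real (Suc m)"] *[of "real (Suc m) - 1/2"] *[of "real (Suc m) + 1/2"]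
      by (intro telescoped_square_bound t) (simp_all add: algebra_simps)
    have 2: "norm (1 / (of_nat (Suc n) * z - of_nat (Suc m))\<^sup>2 - e (of_nat (Suc n) * z - of_nat (Suc m))) \<le> 1 / t\<^sup>2"
      unfolding e_def
      using *[of "- real (Suc m)"] *[of "- real (Suc m) - 1/2"] *[of "- real (Suc m) + 1/2"]
      by (intro telescoped_square_bound t) (simp_all add: algebra_simps)
    have "norm (a m n - b m n) \<le> 1 / t\<^sup>2 + 1 / t\<^sup>2"
      unfolding a_def b_def using norm_triangle_mono[OF 1 2] by (simp add: algebra_simps)
    also have "\<dots> = 8 / c\<^sup>2 * (1 / real (Suc m) ^ 2 * (1 / real (Suc n) ^ 2))"
      unfolding t_def by (simp add: power_mult_distrib power_divide)
    finally show ?thesis .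
  qed
  have "(\<lambda>x. norm ((\<lambda>(m, n). a m n - b m n) x)) summable_on UNIV \<times> UNIV"
  proof (rule Infinite_Sum.abs_summable_on_comparison_test')
    have s: "summable (\<lambda>n. 1 / real (Suc n) ^ 2)"
      using inverse_squares_sums by (simp add: sums_iff add.commute)
    show "(\<lambda>(m, n). 8 / c\<^sup>2 * (1 / real (Suc m) ^ 2) * (1 / real (Suc n) ^ 2)) summable_on UNIV \<times> UNIV"
      by (rule summable_on_product_nonneg[OF summable_mult[OF s] s]) auto
  qed (use bound in \<open>auto simp: mult.assoc\<close>)
  hence "(\<lambda>(m, n). a m n - b m n) summable_on UNIV \<times> UNIV"
    by (rule abs_summable_summable)
  then obtain D where rows: "(\<lambda>n. suminf (\<lambda>m. a m n - b m n)) sums D"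
    and cols: "(\<lambda>m. suminf (\<lambda>n. a m n - b m n)) sums D"
    by (rule suminf_sums_swap)
  have a_row: "(\<lambda>m. a m n) sums ((of_real pi / sin (of_real pi * (of_nat (Suc n) * z)))\<^sup>2 - 1 / (of_nat (Suc n) * z)\<^sup>2)" for n
    unfolding a_def by (rule sums_csc_sq, rule notin_Ints_if_Im) (use z in simp)
  have Ints: "of_real \<mu> / z \<notin> \<int>" if "\<mu> \<noteq> 0" for \<mu>
  proof (rule notin_Ints_if_Im)
    have "Im (of_real \<mu> / z) = \<mu> * Im (1 / z)" by (simp add: Im_divide)
    thus "Im (of_real \<mu> / z) \<noteq> 0" using that Imz' by simp
  qed
  \<comment> \<open>For fixed m the sum runs over n: (nz + m)^2 = z^2 (n + m/z)^2, so the column is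
    a squared cosecant at m/z, which does not change under m/z -> -m/z.\<close>
  have a_col: "(\<lambda>n. a m n) sums ((of_real pi / sin (of_real pi * (of_nat (Suc m) * (- 1 / z))))\<^sup>2 / z\<^sup>2 - 1 / (of_nat (Suc m))\<^sup>2)" for m
  proof -
    have "(\<lambda>k. (1 / (of_nat (Suc m) / z + of_nat (Suc k))\<^sup>2 + 1 / (of_nat (Suc m) / z - of_nat (Suc k))\<^sup>2) / z\<^sup>2) sums
      (((of_real pi / sin (of_real pi * (of_nat (Suc m) / z)))\<^sup>2 - 1 / (of_nat (Suc m) / z)\<^sup>2) / z\<^sup>2)"
      using Ints[of "real (Suc m)"] by (intro sums_divide sums_csc_sq) simp
    also have "(\<lambda>k. (1 / (of_nat (Suc m) / z + of_nat (Suc k))\<^sup>2 + 1 / (of_nat (Suc m) / z - of_nat (Suc k))\<^sup>2) / z\<^sup>2) = a m"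
    proof
      fix k
      have "of_nat (Suc m) / z + of_nat (Suc k) = (of_nat (Suc k) * z + of_nat (Suc m)) / z"
           "of_nat (Suc m) / z - of_nat (Suc k) = - ((of_nat (Suc k) * z - of_nat (Suc m)) / z)"
        using z0 by (simp_all add: field_simps)
      thus "(1 / (of_nat (Suc m) / z + of_nat (Suc k))\<^sup>2 + 1 / (of_nat (Suc m) / z - of_nat (Suc k))\<^sup>2) / z\<^sup>2 = a m k"
        unfolding a_def using z0 by (simp only: power2_minus power_divide) (simp add: add_divide_distrib)
    qed
    finally show ?thesis using z0 by (simp add: diff_divide_distrib power_divide)
  qed
  have T_sums: "(\<lambda>n. (1 / (of_nat (Suc n) * z + of_real \<mu>) - 1 / (of_nat (Suc n) * z - of_real \<mu>))) sums T \<mu>" if "\<mu> \<noteq> 0" for \<mu>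
  proof -
    have "(\<lambda>k. 2 * (of_real \<mu> / z) / ((of_real \<mu> / z)\<^sup>2 - of_nat (Suc k) ^ 2) / z) sums T \<mu>"
      unfolding T_def by (intro sums_divide cot_partial_fractions Ints that)
    moreover have "2 * (of_real \<mu> / z) / ((of_real \<mu> / z)\<^sup>2 - of_nat (Suc k) ^ 2) / z
       = 1 / (of_nat (Suc k) * z + of_real \<mu>) - 1 / (of_nat (Suc k) * z - of_real \<mu>)" for k
    proof -
      have im: "Im (of_nat (Suc k) * z + of_real \<mu>) > 0" "Im (of_nat (Suc k) * z - of_real \<mu>) > 0"
        using z by auto
      hence n: "of_nat (Suc k) * z + of_real \<mu> \<noteq> 0" "of_nat (Suc k) * z - of_real \<mu> \<noteq> 0"
        by (metis less_irrefl zero_complex.sel(2))+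
      have "(of_real \<mu> / z)\<^sup>2 - of_nat (Suc k) ^ 2 = - ((of_nat (Suc k) * z + of_real \<mu>) * (of_nat (Suc k) * z - of_real \<mu>)) / z\<^sup>2"
        using z0 by (simp add: field_simps power2_eq_square)
      hence "2 * (of_real \<mu> / z) / ((of_real \<mu> / z)\<^sup>2 - of_nat (Suc k) ^ 2) / z
          = - 2 * of_real \<mu> / ((of_nat (Suc k) * z + of_real \<mu>) * (of_nat (Suc k) * z - of_real \<mu>))"
        using z0 by (simp add: power2_eq_square)
      also have "\<dots> = 1 / (of_nat (Suc k) * z + of_real \<mu>) - 1 / (of_nat (Suc k) * z - of_real \<mu>)"
        using n by (simp add: diff_frac_eq)
      finally show ?thesis .
    qed
    ultimately show ?thesis by simp
  qed
  have b_col: "(\<lambda>n. b m n) sums (T (real m + 1/2) - T (real (Suc m) + 1/2))" for m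
  proof -
    have "(\<lambda>n. (1 / (of_nat (Suc n) * z + of_real (real m + 1/2)) - 1 / (of_nat (Suc n) * z - of_real (real m + 1/2)))
      - (1 / (of_nat (Suc n) * z + of_real (real (Suc m) + 1/2)) - 1 / (of_nat (Suc n) * z - of_real (real (Suc m) + 1/2))))
       sums (T (real m + 1/2) - T (real (Suc m) + 1/2))"
      by (intro sums_diff T_sums) auto
    moreover have "(1 / (of_nat (Suc n) * z + of_real (real m + 1/2)) - 1 / (of_nat (Suc n) * z - of_real (real m + 1/2)))
      - (1 / (of_nat (Suc n) * z + of_real (real (Suc m) + 1/2)) - 1 / (of_nat (Suc n) * z - of_real (real (Suc m) + 1/2))) = b m n" for n
      unfolding b_def e_def by (simp add: algebra_simps)
    ultimately show ?thesis by simp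
  qed
  \<comment> \<open>Along a row the terms telescope and vanish at infinity, so only the boundary at
    1/2 remains.\<close>
  have b_row: "(\<lambda>m. b m n) sums (1 / (of_nat (Suc n) * z + of_real (1/2)) - 1 / (of_nat (Suc n) * z - of_real (1/2)))" for n
  proof -
    define w where "w = of_nat (Suc n) * z"
    have lim1: "(\<lambda>k. 1 / (w + 1/2 + of_nat k)) \<longlonglongrightarrow> 0"
      by (intro tendsto_divide_0[OF tendsto_const] tendsto_add_filterlim_at_infinity[OF tendsto_const]
            tendsto_of_nat)
    have lim2: "(\<lambda>k. 1 / (1/2 - w + of_nat k)) \<longlonglongrightarrow> 0"
      by (intro tendsto_divide_0[OF tendsto_const] tendsto_add_filterlim_at_infinity[OF tendsto_const]
            tendsto_of_nat)
    have "(\<lambda>k. (1 / (w + 1/2 + of_nat k) - 1 / (w + 1/2 + of_nat (Suc k)))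
             + (1 / (1/2 - w + of_nat k) - 1 / (1/2 - w + of_nat (Suc k)))) sums
          ((1 / (w + 1/2 + of_nat 0) - 0) + (1 / (1/2 - w + of_nat 0) - 0))"
      by (intro sums_add telescope_sums' lim1 lim2)
    moreover have "(1 / (w + 1/2 + of_nat k) - 1 / (w + 1/2 + of_nat (Suc k)))
             + (1 / (1/2 - w + of_nat k) - 1 / (1/2 - w + of_nat (Suc k))) = b k n" for k
    proof -
      have 1: "1/2 - w + of_nat k = - (w - of_nat (Suc k) + 1/2)"
           "1/2 - w + of_nat (Suc k) = - (w - of_nat (Suc k) - 1/2)"
           "w + 1/2 + of_nat k = w + of_nat (Suc k) - 1/2"
           "w + 1/2 + of_nat (Suc k) = w + of_nat (Suc k) + 1/2"
        by (simp_all add: algebra_simps)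
      show ?thesis unfolding b_def e_def w_def[symmetric] 1 by (simp add: divide_minus_right del: minus_diff_eq minus_add_distrib of_nat_Suc)
    qed
    moreover have "1 / (1/2 - w + of_nat 0) = - (1 / (w - 1/2))"
    proof -
      have "1/2 - w + of_nat 0 = - (w - 1/2)" by simp
      thus ?thesis by (simp only: divide_minus_right)
    qed
    ultimately show ?thesis by (simp add: w_def)
  qed
  \<comment> \<open>Since Im (1/z) < 0, the argument of cot runs down the lower half plane. This
    limit is the whole discrepancy between rows and columns.\<close>
  have T_lim: "(\<lambda>m. T (real m + 1/2)) \<longlonglongrightarrow> \<i> * of_real pi / z"
  proof -
    have top: "filterlim (\<lambda>m. real m + 1/2) at_top sequentially" by real_asymp
    have "filterlim (\<lambda>m. (real m + 1/2) * Im (1 / z)) at_bot sequentially"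
      using filterlim_tendsto_neg_mult_at_bot[OF tendsto_const Imz' top] by (simp add: mult.commute)
    moreover have "Im (of_real (real m + 1/2) / z) = (real m + 1/2) * Im (1 / z)" for m
      by (simp add: Im_divide)
    ultimately have 1: "(\<lambda>m. cot (of_real pi * (of_real (real m + 1/2) / z))) \<longlonglongrightarrow> \<i>"
      by (intro tendsto_cot_lower) simp
    have "(\<lambda>m. z / of_real (real m + 1/2)) \<longlonglongrightarrow> 0"
      by (intro tendsto_divide_0[OF tendsto_const] filterlim_compose[OF filterlim_of_real_at_infinity top])
    hence "(\<lambda>m. (of_real pi * cot (of_real pi * (of_real (real m + 1/2) / z)) - z / of_real (real m + 1/2)) / z)
       \<longlonglongrightarrow> (of_real pi * \<i> - 0) / z"
      using z0 by (intro tendsto_intros 1) auto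
    thus ?thesis by (simp add: T_def mult.commute)
  qed
  have r: "(\<lambda>n. (of_real pi / sin (of_real pi * (of_nat (Suc n) * z)))\<^sup>2 - 1 / (of_nat (Suc n) * z)\<^sup>2) sums (D + T (1/2))"
  proof -
    have "suminf (\<lambda>m. a m n - b m n) = (of_real pi / sin (of_real pi * (of_nat (Suc n) * z)))\<^sup>2 - 1 / (of_nat (Suc n) * z)\<^sup>2 -
      (1 / (of_nat (Suc n) * z + of_real (1/2)) - 1 / (of_nat (Suc n) * z - of_real (1/2)))" for n
      by (intro sums_unique[symmetric] sums_diff a_row b_row)
    hence "(\<lambda>n. (of_real pi / sin (of_real pi * (of_nat (Suc n) * z)))\<^sup>2 - 1 / (of_nat (Suc n) * z)\<^sup>2 -
      (1 / (of_nat (Suc n) * z + of_real (1/2)) - 1 / (of_nat (Suc n) * z - of_real (1/2)))) sums D"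
      using rows by simp
    from sums_add[OF this T_sums[of "1/2"]] show ?thesis by simp
  qed
  have cc: "(\<lambda>m. (of_real pi / sin (of_real pi * (of_nat (Suc m) * (- 1 / z))))\<^sup>2 / z\<^sup>2 - 1 / (of_nat (Suc m))\<^sup>2)
     sums (D + (T (1/2) - \<i> * of_real pi / z))"
  proof -
    have "suminf (\<lambda>n. a m n - b m n) = (of_real pi / sin (of_real pi * (of_nat (Suc m) * (- 1 / z))))\<^sup>2 / z\<^sup>2 - 1 / (of_nat (Suc m))\<^sup>2 -
      (T (real m + 1/2) - T (real (Suc m) + 1/2))" for m
      by (intro sums_unique[symmetric] sums_diff a_col b_col)
    hence "(\<lambda>m. (of_real pi / sin (of_real pi * (of_nat (Suc m) * (- 1 / z))))\<^sup>2 / z\<^sup>2 - 1 / (of_nat (Suc m))\<^sup>2 -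
      (T (real m + 1/2) - T (real (Suc m) + 1/2))) sums D"
      using cols by simp
    moreover have "(\<lambda>m. T (real m + 1/2) - T (real (Suc m) + 1/2)) sums (T (real 0 + 1/2) - \<i> * of_real pi / z)"
      by (rule telescope_sums'[OF T_lim])
    ultimately show ?thesis using sums_add by fastforce
  qed
  \<comment> \<open>Basel sums restore what was split off: the terms m = 0 of the rows and n = 0 of
    the columns.\<close>
  have basel: "(\<lambda>n. 1 / (of_nat (Suc n))\<^sup>2) sums (of_real pi ^ 2 / 6 :: complex)"
    using sums_of_real[OF inverse_squares_sums, where 'a = complex] by (simp add: add.commute)
  show ?thesis
  proof (rule that[of "D + T (1/2)"])
    have "(\<lambda>n. 1 / (of_nat (Suc n))\<^sup>2 / z\<^sup>2) sums (of_real pi ^ 2 / 6 / z\<^sup>2)"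
      by (intro sums_divide basel)
    from sums_add[OF r this]
    show "(\<lambda>n. (of_real pi / sin (of_real pi * (of_nat (Suc n) * z)))\<^sup>2) sums (D + T (1/2) + of_real pi ^ 2 / (6 * z\<^sup>2))"
      by (simp add: power_mult_distrib)
    from sums_add[OF cc basel]
    show "(\<lambda>n. (of_real pi / sin (of_real pi * (of_nat (Suc n) * (- 1 / z))))\<^sup>2 / z\<^sup>2) sums
        (D + T (1/2) + of_real pi ^ 2 / 6 - \<i> * of_real pi / z)"
      by (simp add: algebra_simps)
  qed
qed

subsection \<open>The inversion of the eta function\<close>

text \<open>The variable is q and not z because the final argument needs a function that is
  holomorphic at q = 0, that is, at the cusp.\<close>

definition euler_prod :: "complex \<Rightarrow> complex" where
  "euler_prod q = (\<Prod>n. 1 - q ^ Suc n)"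

lemma convergent_euler_prod:
  fixes q :: complex
  assumes "norm q < 1"
  shows "convergent_prod (\<lambda>n. 1 - q ^ Suc n)"
proof -
  have "summable (\<lambda>n. norm (q ^ Suc n))"
    using assms by (simp add: norm_power norm_mult summable_mult summable_geometric)
  hence "abs_convergent_prod (\<lambda>n. 1 - q ^ Suc n)"
    by (subst abs_convergent_prod_conv_summable) (simp add: norm_minus_commute)
  thus ?thesis by (rule abs_convergent_prod_imp_convergent_prod)
qed

lemma power_Suc_neq_1:
  fixes q :: complex
  assumes "norm q < 1"
  shows "1 - q ^ Suc n \<noteq> 0"
proof
  assume "1 - q ^ Suc n = 0"
  hence "norm q ^ Suc n = 1" by (metis eq_iff_diff_eq_0 norm_one norm_power)
  moreover have "norm q ^ Suc n \<le> norm q ^ 1"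
    using assms by (intro power_decreasing) auto
  ultimately show False using assms by simp
qed

lemma euler_prod_nonzero:
  assumes "norm q < 1"
  shows "euler_prod q \<noteq> 0"
  unfolding euler_prod_def
  by (intro prodinf_nonzero convergent_euler_prod power_Suc_neq_1 assms)

lemma euler_prod_0 [simp]: "euler_prod 0 = 1"
  by (simp add: euler_prod_def)

lemma euler_prod_LIMSEQ:
  assumes "norm q < 1"
  shows "(\<lambda>n. \<Prod>k<n. 1 - q ^ Suc k) \<longlonglongrightarrow> euler_prod q"
  using convergent_prod_LIMSEQ[OF convergent_euler_prod[OF assms]]
  unfolding euler_prod_def LIMSEQ_lessThan_iff_atMost .

lemma uniform_limit_euler_prod:
  assumes "r < 1"
  shows "uniform_limit (cball 0 r) (\<lambda>n q. \<Prod>k<n. 1 - q ^ Suc k) euler_prod sequentially"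
proof (cases "r \<ge> 0")
  case True
  have "uniformly_convergent_on (cball 0 r) (\<lambda>N q. \<Sum>n<N. norm ((1 - q ^ Suc n) - 1 :: complex))"
  proof (rule Weierstrass_m_test')
    show "norm (norm ((1 - q ^ Suc n) - 1 :: complex)) \<le> r ^ Suc n" if "q \<in> cball 0 r" for n q
      using power_mono[of "norm q" r "Suc n"] that by (simp add: norm_power norm_mult)
    show "summable (\<lambda>n. r ^ Suc n)"
      using True assms by (simp add: summable_mult summable_geometric)
  qed
  hence "uniformly_convergent_on (cball 0 r) (\<lambda>N q :: complex. \<Prod>n<N. 1 - q ^ Suc n)"
    by (intro uniformly_convergent_on_prod') (auto intro!: continuous_intros)
  then obtain l where l: "uniform_limit (cball 0 r) (\<lambda>N q :: complex. \<Prod>n<N. 1 - q ^ Suc n) l sequentially"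
    by (auto simp: uniformly_convergent_on_def)
  have "l q = euler_prod q" if "q \<in> cball 0 r" for q
  proof (rule LIMSEQ_unique)
    show "(\<lambda>n. \<Prod>k<n. 1 - q ^ Suc k) \<longlonglongrightarrow> l q"
      using tendsto_uniform_limitI[OF l that] .
    show "(\<lambda>n. \<Prod>k<n. 1 - q ^ Suc k) \<longlonglongrightarrow> euler_prod q"
      using that assms by (intro euler_prod_LIMSEQ) auto
  qed
  with l show ?thesis
    by (metis (mono_tags, lifting) uniform_limit_cong')
qed auto

lemma uniform_limit_euler_prod_ball:
  assumes "r < 1"
  shows "uniform_limit (ball 0 r) (\<lambda>n q. \<Prod>k<n. 1 - q ^ Suc k) euler_prod sequentially"
  by (rule uniform_limit_on_subset[OF uniform_limit_euler_prod[OF assms]]) auto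

lemma holomorphic_euler_prod: "euler_prod holomorphic_on ball 0 1"
proof (rule holomorphic_uniform_sequence)
  fix q :: complex assume q: "q \<in> ball 0 1"
  define d where "d = (1 - norm q) / 2"
  have d: "d > 0" and sub: "cball q d \<subseteq> cball 0 ((1 + norm q) / 2)" and lt: "(1 + norm q) / 2 < 1"
    using q by (auto simp: d_def field_simps cball_subset_cball_iff)
  have "cball q d \<subseteq> ball 0 1"
    using sub lt by force
  with d sub show "\<exists>d>0. cball q d \<subseteq> ball 0 1 \<and>
      uniform_limit (cball q d) (\<lambda>n q. \<Prod>k<n. 1 - q ^ Suc k) euler_prod sequentially"
    using uniform_limit_on_subset[OF uniform_limit_euler_prod[OF lt]] by blast
qed (auto intro!: holomorphic_intros)

text \<open>Uniform convergence of the partial products on a disc around q allows the logarithmic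
  derivative to be taken factor by factor; the result is the Lambert series of the divisor
  sum.\<close>

lemma sums_logderiv_euler_prod:
  assumes "norm q < 1"
  shows "(\<lambda>k. of_nat (Suc k) * q ^ Suc k / (1 - q ^ Suc k)) sums (- (q * deriv euler_prod q / euler_prod q))"
proof -
  obtain r where r: "norm q < r" "r < 1" using assms dense by blast
  have "(\<lambda>k. deriv (\<lambda>q. 1 - q ^ Suc k) q / (1 - q ^ Suc k)) sums (deriv euler_prod q / euler_prod q)"
  proof (rule logderiv_prodinf_complex_uniform_limit)
    show "uniform_limit (ball 0 r) (\<lambda>n q. \<Prod>k<n. 1 - q ^ Suc k) euler_prod sequentially"
      by (rule uniform_limit_euler_prod_ball[OF r(2)])
  qed (use r in \<open>auto intro!: holomorphic_intros euler_prod_nonzero\<close>)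
  moreover have "deriv (\<lambda>q. 1 - q ^ Suc k) q = - (of_nat (Suc k) * q ^ k)" for k
    by (rule DERIV_imp_deriv) (rule derivative_eq_intros refl | simp)+
  ultimately have "(\<lambda>k. - q * (- (of_nat (Suc k) * q ^ k) / (1 - q ^ Suc k))) sums (- q * (deriv euler_prod q / euler_prod q))"
    by (intro sums_mult) simp
  thus ?thesis by (simp add: mult_ac)
qed

section \<open>The logarithmic derivative of eta and its inversion\<close>

lemma q_pow_eq_power: "q_pow (real n) z = q_pow 1 z ^ n"
  by (simp add: q_pow_def mult_ac flip: exp_of_nat_mult)

lemma norm_q_pow: "norm (q_pow r z) = exp (- 2 * pi * r * Im z)"
  by (simp add: q_pow_def norm_exp_eq_Re)

lemma norm_q_pow_1_less: "Im z > 0 \<Longrightarrow> norm (q_pow 1 z) < 1"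
  by (simp add: norm_q_pow)

lemma dedekind_eta_altdef: "dedekind_eta z = q_pow (1 / 24) z * euler_prod (q_pow 1 z)"
  by (simp only: dedekind_eta_def euler_prod_def q_pow_eq_power)

lemma dedekind_eta_nonzero: "Im z > 0 \<Longrightarrow> dedekind_eta z \<noteq> 0"
  by (simp add: dedekind_eta_altdef euler_prod_nonzero norm_q_pow_1_less) (simp add: q_pow_def)

text \<open>The double series of k q^(km) is summed in both orders: over m first it is the Lambert
  series of \<open>sums_logderiv_euler_prod\<close>, over k first it gives the squared cosecants by
  \<open>sums_csc_sq_exp\<close> at mz.\<close>

lemma sums_csc_sq_logderiv:
  assumes z: "Im z > 0"
  shows "(\<lambda>m. (of_real pi / sin (of_real pi * (of_nat (Suc m) * z)))\<^sup>2) sums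
           (4 * of_real pi ^ 2 * (q_pow 1 z * deriv euler_prod (q_pow 1 z) / euler_prod (q_pow 1 z)))"
proof -
  define q where "q = q_pow 1 z"
  have q: "norm q < 1" using norm_q_pow_1_less[OF z] by (simp add: q_def)
  define f where "f = (\<lambda>k m. of_nat (Suc k) * q ^ (Suc k * Suc m))"
  have "(\<lambda>x. norm ((\<lambda>(k, m). f k m) x)) summable_on UNIV \<times> UNIV"
  proof (rule Infinite_Sum.abs_summable_on_comparison_test')
    have "summable (\<lambda>k. of_nat (Suc k) * norm q ^ k)"
      using geometric_deriv_sums[of "norm q"] q by (auto simp: sums_iff)
    moreover have "summable (\<lambda>m. norm q ^ m)"
      using q by (simp add: summable_geometric)
    ultimately show "(\<lambda>(k, m). (of_nat (Suc k) * norm q ^ k) * norm q ^ m) summable_on UNIV \<times> UNIV"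
      by (rule summable_on_product_nonneg) auto
    show "norm ((\<lambda>(k, m). f k m) x) \<le> (\<lambda>(k, m). (of_nat (Suc k) * norm q ^ k) * norm q ^ m) x" for x
    proof (cases x)
      case (Pair k m)
      \<comment> \<open>Replacing the exponent (k+1)(m+1) by the smaller k + m separates the two
        variables.\<close>
      have "norm q ^ (Suc k * Suc m) \<le> norm q ^ (k + m)"
        using q by (intro power_decreasing) auto
      thus ?thesis
        by (simp add: Pair f_def norm_mult norm_power power_add mult.assoc del: of_nat_Suc mult_Suc mult_Suc_right)
    qed
  qed
  hence "(\<lambda>(k, m). f k m) summable_on UNIV \<times> UNIV" by (rule abs_summable_summable)
  then obtain D where D: "(\<lambda>k. suminf (f k)) sums D" "(\<lambda>m. suminf (\<lambda>k. f k m)) sums D"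
    by (rule suminf_sums_swap)
  have "suminf (f k) = of_nat (Suc k) * q ^ Suc k / (1 - q ^ Suc k)" for k
  proof -
    have "norm (q ^ Suc k) < 1"
      using q power_decreasing[of 1 "Suc k" "norm q"] by (simp add: norm_power norm_mult)
    from sums_mult[OF geometric_sums[OF this], of "of_nat (Suc k) * q ^ Suc k"]
    have "f k sums (of_nat (Suc k) * q ^ Suc k * (1 / (1 - q ^ Suc k)))"
      by (simp only: f_def mult_Suc_right power_add power_mult mult.assoc)
    thus ?thesis by (simp add: sums_iff)
  qed
  with D(1) have D1: "D = - (q * deriv euler_prod q / euler_prod q)"
    using sums_logderiv_euler_prod[OF q] sums_unique2 by simp
  have "suminf (\<lambda>k. f k m) = - 1 / (4 * of_real pi ^ 2) * (of_real pi / sin (of_real pi * (of_nat (Suc m) * z)))\<^sup>2" for m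
  proof -
    have "(\<lambda>k. of_nat (Suc k) * q_pow (of_nat (Suc k)) (of_nat (Suc m) * z)) sums
        (- 1 / (4 * of_real pi ^ 2) * (of_real pi / sin (of_real pi * (of_nat (Suc m) * z)))\<^sup>2)"
      by (rule sums_csc_sq_exp) (use z in simp)
    moreover have "q_pow (of_nat (Suc k)) (of_nat (Suc m) * z) = q ^ (Suc k * Suc m)" for k
      unfolding q_def q_pow_def exp_of_nat_mult[symmetric] by (simp add: algebra_simps)
    ultimately show ?thesis by (simp only: f_def sums_iff)
  qed
  with D(2) have "(\<lambda>m. - 1 / (4 * of_real pi ^ 2) * (of_real pi / sin (of_real pi * (of_nat (Suc m) * z)))\<^sup>2) sums D"
    by simp
  from sums_mult[OF this, of "- 4 * of_real pi ^ 2"] show ?thesis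
    by (simp add: D1 q_def)
qed

text \<open>The value A of the sum is left as a parameter so that
  \<open>sums_csc_sq_inversion\<close> can supply it at z and at -1/z in terms of the same
  X.\<close>

lemma has_field_derivative_dedekind_eta:
  assumes z: "Im z > 0"
    and A: "(\<lambda>m. (of_real pi / sin (of_real pi * (of_nat (Suc m) * z)))\<^sup>2) sums A"
  shows "(dedekind_eta has_field_derivative
           dedekind_eta z * (of_real pi * \<i> / 12 + \<i> / (2 * of_real pi) * A)) (at z)"
proof -
  define q where "q = q_pow 1 z"
  have q: "norm q < 1" using norm_q_pow_1_less[OF z] by (simp add: q_def)
  have "(euler_prod has_field_derivative deriv euler_prod q) (at q)"
    by (rule holomorphic_derivI[OF holomorphic_euler_prod]) (use q in auto)
  moreover have "(q_pow 1 has_field_derivative 2 * of_real pi * \<i> * q) (at z)"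
    unfolding q_pow_def q_def by (auto intro!: derivative_eq_intros)
  ultimately have E: "((\<lambda>z. euler_prod (q_pow 1 z)) has_field_derivative deriv euler_prod q * (2 * of_real pi * \<i> * q)) (at z)"
    unfolding q_def by (rule DERIV_chain2)
  have F: "(q_pow (1/24) has_field_derivative of_real pi * \<i> / 12 * q_pow (1/24) z) (at z)"
    unfolding q_pow_def by (auto intro!: derivative_eq_intros)
  have "(dedekind_eta has_field_derivative
      of_real pi * \<i> / 12 * q_pow (1/24) z * euler_prod q + deriv euler_prod q * (2 * of_real pi * \<i> * q) * q_pow (1/24) z) (at z)"
    unfolding dedekind_eta_altdef[abs_def] using DERIV_mult[OF F E] by (simp add: q_def)
  moreover have "A = 4 * of_real pi ^ 2 * (q * deriv euler_prod q / euler_prod q)"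
    using sums_csc_sq_logderiv[OF z] A sums_unique2 unfolding q_def by blast
  ultimately show ?thesis
    using euler_prod_nonzero[OF q]
    by (auto simp: dedekind_eta_altdef field_simps power2_eq_square simp flip: q_def elim!: DERIV_cong)
qed

text \<open>The quotient \<open>R\<close> has derivative zero on the convex upper half plane and is
  therefore constant.\<close>

lemma dedekind_eta_inversion:
  assumes z: "Im z > 0"
  shows "dedekind_eta (- 1 / z) = 1 / \<i> powr (1/2) * z powr (1/2) * dedekind_eta z"
proof -
  define H where "H = {z. Im z > 0}"
  define R where "R = (\<lambda>z. dedekind_eta (- 1 / z) / (z powr (1/2) * dedekind_eta z))"
  have "convex H" unfolding H_def by (rule convex_halfspace_Im_gt)
  have "(R has_field_derivative 0) (at w within H)" if "w \<in> H" for w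
  proof -
    have w: "Im w > 0" "w \<noteq> 0" "w \<notin> \<real>\<^sub>\<le>\<^sub>0" using that by (auto simp: H_def complex_nonpos_Reals_iff)
    have w': "Im (- 1 / w) > 0"
      using w by (simp add: Im_divide add_nonneg_pos)
    obtain X where X:
      "(\<lambda>n. (of_real pi / sin (of_real pi * (of_nat (Suc n) * w)))\<^sup>2) sums (X + of_real pi ^ 2 / (6 * w\<^sup>2))"
      "(\<lambda>n. (of_real pi / sin (of_real pi * (of_nat (Suc n) * (- 1 / w))))\<^sup>2 / w\<^sup>2) sums
          (X + of_real pi ^ 2 / 6 - \<i> * of_real pi / w)"
      using sums_csc_sq_inversion[OF w(1)] by blast
    define Y where "Y = (X + of_real pi ^ 2 / 6 - \<i> * of_real pi / w) * w\<^sup>2"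
    have Y: "(\<lambda>n. (of_real pi / sin (of_real pi * (of_nat (Suc n) * (- 1 / w))))\<^sup>2) sums Y"
      using sums_mult2[OF X(2), of "w\<^sup>2"] w by (simp add: Y_def)
    define a where "a = of_real pi * \<i> / 12 + \<i> / (2 * of_real pi) * (X + of_real pi ^ 2 / (6 * w\<^sup>2))"
    define b where "b = of_real pi * \<i> / 12 + \<i> / (2 * of_real pi) * Y"
    have d1: "(dedekind_eta has_field_derivative dedekind_eta w * a) (at w)"
      unfolding a_def by (rule has_field_derivative_dedekind_eta[OF w(1) X(1)])
    have "(dedekind_eta has_field_derivative dedekind_eta (- 1 / w) * b) (at (- 1 / w))"
      unfolding b_def by (rule has_field_derivative_dedekind_eta[OF w' Y])
    moreover have "((\<lambda>w. - 1 / w) has_field_derivative 1 / w\<^sup>2) (at w)"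
      using w by (auto intro!: derivative_eq_intros simp: power2_eq_square)
    ultimately have d2: "((\<lambda>w. dedekind_eta (- 1 / w)) has_field_derivative dedekind_eta (- 1 / w) * b * (1 / w\<^sup>2)) (at w)"
      by (rule DERIV_chain2)
    have d3: "((\<lambda>w. w powr (1/2)) has_field_derivative w powr (1/2) * (1 / (2 * w))) (at w)"
    proof -
      have e: "w powr (1/2 - 1) = w powr (1/2) / w"
        using powr_diff[of w "1/2" 1] w(2) by simp
      show ?thesis
        using has_field_derivative_powr[OF w(3), of "1/2"] unfolding e by simp
    qed
    \<comment> \<open>The Basel terms of one side match the contributions of q^(1/24) on the other.
      What remains is the anomaly -i pi/w, which times i/(2 pi) is 1/(2w), the logarithmic
      derivative of the square root.\<close>
    have ba: "b * (1 / w\<^sup>2) = a + 1 / (2 * w)"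
      unfolding a_def b_def Y_def using w by (simp add: field_simps power2_eq_square)
    have nz: "w powr (1/2) * dedekind_eta w \<noteq> 0"
      using w dedekind_eta_nonzero by auto
    have "(R has_field_derivative
        (dedekind_eta (- 1 / w) * b * (1 / w\<^sup>2) * (w powr (1/2) * dedekind_eta w)
         - dedekind_eta (- 1 / w) * (w powr (1/2) * (1 / (2 * w)) * dedekind_eta w + dedekind_eta w * a * w powr (1/2)))
         / ((w powr (1/2) * dedekind_eta w) * (w powr (1/2) * dedekind_eta w))) (at w)"
      unfolding R_def by (rule DERIV_divide[OF d2 DERIV_mult[OF d3 d1] nz])
    also have "dedekind_eta (- 1 / w) * b * (1 / w\<^sup>2) * (w powr (1/2) * dedekind_eta w)
         - dedekind_eta (- 1 / w) * (w powr (1/2) * (1 / (2 * w)) * dedekind_eta w + dedekind_eta w * a * w powr (1/2))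
       = dedekind_eta (- 1 / w) * w powr (1/2) * dedekind_eta w * (b * (1 / w\<^sup>2) - (a + 1 / (2 * w)))"
      by (simp add: algebra_simps)
    finally show ?thesis
      by (simp only: ba diff_self mult_zero_right div_0 has_field_derivative_at_within)
  qed
  hence "R constant_on H"
    using \<open>convex H\<close> has_field_derivative_zero_constant unfolding constant_on_def by metis
  moreover have "z \<in> H" "\<i> \<in> H" using z by (auto simp: H_def)
  ultimately have "R z = R \<i>" unfolding constant_on_def by metis
  \<comment> \<open>The constant is read off at i, the fixed point of the inversion.\<close>
  moreover have "R \<i> = 1 / \<i> powr (1/2)"
    using dedekind_eta_nonzero[of \<i>] by (simp add: R_def)
  moreover have "dedekind_eta (- 1 / z) = R z * (z powr (1/2) * dedekind_eta z)"
    using z dedekind_eta_nonzero[OF z] by (auto simp: R_def)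
  ultimately show ?thesis by (simp only: mult.assoc)
qed

subsection \<open>The incomplete Gamma function\<close>

text \<open>The part of \<open>inc_Gamma (p + 1)\<close> along the real ray; its real values are
  what the estimates need.\<close>

definition exp_powr_tail :: "real \<Rightarrow> real \<Rightarrow> real" where
  "exp_powr_tail p y = integral {y..} (\<lambda>t. exp (- t) * t powr p)"

lemma exp_powr_integrable:
  fixes p y :: real
  assumes "p \<le> 0" "y > 0"
  shows "(\<lambda>t. exp (- t) * t powr p) integrable_on {y..}"
proof (rule measurable_bounded_by_integrable_imp_integrable)
  show "(\<lambda>t. exp (- t) * t powr p) \<in> borel_measurable (lebesgue_on {y..})"
    using assms by (intro continuous_imp_measurable_on_sets_lebesgue continuous_intros) auto
  show "(\<lambda>t. exp (- t) * y powr p) integrable_on {y..}"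
    using integrable_on_exp_minus_to_infinity[of 1 y] by (intro integrable_on_mult_left) simp
  fix t assume "t \<in> {y..}"
  thus "norm (exp (- t) * t powr p) \<le> exp (- t) * y powr p"
    using assms powr_mono2'[of p y t] by (simp add: abs_mult)
qed auto

lemma exp_powr_tail_split:
  assumes "p \<le> 0" "0 < a" "a \<le> y"
  shows "exp_powr_tail p a = integral {a..y} (\<lambda>t. exp (- t) * t powr p) + exp_powr_tail p y"
proof -
  have "(\<lambda>t. exp (- t) * t powr p) integrable_on {a..y}"
    by (rule integrable_on_subinterval[OF exp_powr_integrable[OF assms(1,2)]]) auto
  moreover have "(\<lambda>t. exp (- t) * t powr p) integrable_on {y..}"
    using assms by (intro exp_powr_integrable) auto
  moreover have "{a..y} \<inter> {y..} = {y}" "{a..} = {a..y} \<union> {y..}" using assms by auto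
  ultimately show ?thesis
    unfolding exp_powr_tail_def by (simp add: integral_Un)
qed

lemma exp_powr_tail_has_real_derivative:
  assumes "p \<le> 0" "y > 0"
  shows "(exp_powr_tail p has_real_derivative - (exp (- y) * y powr p)) (at y)"
proof -
  \<comment> \<open>The base point y/2 lies strictly below y, so that the derivative of the integral
    is two-sided.\<close>
  have "((\<lambda>x. integral {y/2..x} (\<lambda>t. exp (- t) * t powr p)) has_real_derivative exp (- y) * y powr p) (at y within {y/2..y+1})"
    using assms by (intro integral_has_real_derivative continuous_intros) auto
  hence "((\<lambda>x. integral {y/2..x} (\<lambda>t. exp (- t) * t powr p)) has_real_derivative exp (- y) * y powr p) (at y)"
    using assms by (subst (asm) at_within_Icc_at) auto
  hence "((\<lambda>x. exp_powr_tail p (y/2) - integral {y/2..x} (\<lambda>t. exp (- t) * t powr p)) has_real_derivative 0 - exp (- y) * y powr p) (at y)"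
    by (intro DERIV_diff DERIV_const)
  hence "(exp_powr_tail p has_real_derivative 0 - exp (- y) * y powr p) (at y)"
  proof (rule has_field_derivative_transform_within_open[where S = "{y/2<..}"])
    fix x assume "x \<in> {y/2<..}"
    thus "exp_powr_tail p (y/2) - integral {y/2..x} (\<lambda>t. exp (- t) * t powr p) = exp_powr_tail p x"
      using exp_powr_tail_split[of p "y/2" x] assms by simp
  qed (use assms in auto)
  thus ?thesis by simp
qed

lemma exp_powr_tail_upper:
  assumes "p \<le> 0" "y > 0"
  shows "exp_powr_tail p y \<le> exp (- y) * y powr p"
proof -
  have "((\<lambda>t. exp (- t) * y powr p) has_integral (exp (- y) * y powr p)) {y..}"
    using has_integral_exp_minus_to_infinity[of 1 y] by (intro has_integral_mult_left) simp
  moreover have "((\<lambda>t. exp (- t) * t powr p) has_integral exp_powr_tail p y) {y..}"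
    unfolding exp_powr_tail_def using exp_powr_integrable[OF assms] by (rule integrable_integral)
  ultimately show ?thesis
    using assms by (elim has_integral_le[rotated]) (auto intro!: powr_mono2')
qed

text \<open>Only the piece over [y, y+1] is kept. The loss of a constant factor is harmless, as the
  bound serves to deduce growth of coefficients from convergence.\<close>

lemma exp_powr_tail_lower:
  assumes "p \<le> 0" "y > 0"
  shows "exp_powr_tail p y \<ge> exp (- (y + 1)) * (y + 1) powr p"
proof -
  have ii: "(\<lambda>t. exp (- t) * t powr p) integrable_on {y..y+1}"
    by (rule integrable_on_subinterval[OF exp_powr_integrable[OF assms]]) auto
  have "integral {y..y+1} (\<lambda>t. exp (- (y + 1)) * (y + 1) powr p) \<le> integral {y..y+1} (\<lambda>t. exp (- t) * t powr p)"
    using assms by (intro integral_le ii) (auto intro!: mult_mono powr_mono2')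
  moreover have "exp_powr_tail p (y + 1) \<ge> 0"
    unfolding exp_powr_tail_def using assms by (intro integral_nonneg exp_powr_integrable) auto
  ultimately show ?thesis
    using exp_powr_tail_split[of p y "y + 1"] assms by simp
qed

lemma inc_Gamma_pos:
  "y > 0 \<Longrightarrow> inc_Gamma s y = of_real (exp_powr_tail (s - 1) y)"
  by (simp add: inc_Gamma_def exp_powr_tail_def)

text \<open>
  The integrand has a primitive on the plane slit along the negative imaginary axis, which
  contains both end points of the half circle; there \<open>(- \<i>w)\<close> avoids the branch cut, and
  on the closed upper half plane the rotated power agrees with the principal one.
\<close>

lemma exp_powr_primitive:
  fixes p :: real
  obtains \<Phi> :: "complex \<Rightarrow> complex" where
    "\<And>w. w \<noteq> 0 \<Longrightarrow> Im w \<ge> 0 \<Longrightarrow> (\<Phi> has_field_derivative exp (- w) * w powr of_real p) (at w)"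
proof -
  define S where "S = - (complex_of_real ` {..0})"
  define f where "f = (\<lambda>v. exp (- (\<i> * v)) * (exp (of_real p * (\<i> * of_real pi / 2)) * v powr of_real p))"
  have Sv: "v \<notin> \<real>\<^sub>\<le>\<^sub>0" if "v \<in> S" for v
    using that by (auto simp: S_def nonpos_Reals_def)
  have hol: "f holomorphic_on S"
    unfolding f_def using Sv by (auto intro!: holomorphic_intros)
  have "S = - \<real>\<^sub>\<le>\<^sub>0" by (auto simp: S_def nonpos_Reals_def)
  hence "open S" by (metis closed_nonpos_Reals_complex open_Compl)
  moreover have "starlike S" unfolding S_def by (rule starlike_slotted_complex_plane_left)
  ultimately obtain g where g: "\<And>v. v \<in> S \<Longrightarrow> (g has_field_derivative f v) (at v)"
    using holomorphic_starlike_primitive[OF holomorphic_on_imp_continuous_on[OF hol] _ _ finite.emptyI]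
      holomorphic_on_imp_differentiable_at[OF hol] by blast
  show ?thesis
  proof (rule that[of "\<lambda>w. \<i> * g (- \<i> * w)"])
    fix w :: complex assume w: "w \<noteq> 0" "Im w \<ge> 0"
    define v where "v = - \<i> * w"
    have wv: "w = \<i> * v" by (simp add: v_def)
    have v: "v \<noteq> 0" "Re v \<ge> 0" using w by (auto simp: v_def)
    hence "v \<in> S" by (auto simp: S_def complex_eq_iff)
    hence "(g has_field_derivative f v) (at (- \<i> * w))" unfolding v_def by (rule g)
    moreover have "((\<lambda>w. - \<i> * w) has_field_derivative - \<i>) (at w)"
      by (auto intro!: derivative_eq_intros)
    ultimately have "((\<lambda>w. g (- \<i> * w)) has_field_derivative f v * - \<i>) (at w)"
      by (rule DERIV_chain2)
    hence "((\<lambda>w. \<i> * g (- \<i> * w)) has_field_derivative \<i> * (f v * - \<i>)) (at w)"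
      by (rule DERIV_cmult)
    moreover have "\<i> * (f v * - \<i>) = exp (- w) * w powr of_real p"
    proof -
      have "w powr of_real p = exp (of_real p * (Ln v + \<i> * of_real pi / 2))"
        using w v Ln_times_ii[OF v(1)] by (simp add: powr_def wv)
      also have "\<dots> = exp (of_real p * (\<i> * of_real pi / 2)) * v powr of_real p"
        using v by (simp add: powr_def distrib_left exp_add mult_ac)
      finally have "f v = exp (- w) * w powr of_real p" by (simp add: f_def wv)
      moreover have "\<i> * (f v * - \<i>) = f v" by (simp add: complex_eq_iff)
      ultimately show ?thesis by simp
    qed
    ultimately show "((\<lambda>w. \<i> * g (- \<i> * w)) has_field_derivative exp (- w) * w powr of_real p) (at w)"
      by simp
  qed
qed

lemma complex_of_real_exp_powr:
  assumes "y \<ge> 0"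
  shows "complex_of_real (exp (- y) * y powr p) = exp (- of_real y) * of_real y powr of_real p"
proof -
  have "complex_of_real (exp (- y)) = exp (- of_real y)"
    using exp_of_real[of "- y", where 'a = complex] by simp
  thus ?thesis using powr_of_real[OF assms, of p] by simp
qed

text \<open>For y < 0 a change of y moves the start of the half circle, its end and the start of the
  ray. The last two both lie at -y and their contributions cancel, so the formula is the same for
  both signs.\<close>

lemma inc_Gamma_has_vector_derivative:
  assumes "s \<le> 1" "y \<noteq> 0"
  shows "(inc_Gamma s has_vector_derivative - (exp (- of_real y) * of_real y powr of_real (s - 1))) (at y)"
proof (cases "y > 0")
  case True
  have "((\<lambda>x. complex_of_real (exp_powr_tail (s - 1) x)) has_vector_derivative
           of_real (- (exp (- y) * y powr (s - 1)))) (at y)"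
    using exp_powr_tail_has_real_derivative[of "s - 1" y] True assms
    by (intro has_vector_derivative_of_real) (auto simp: has_real_derivative_iff_has_vector_derivative)
  hence "(inc_Gamma s has_vector_derivative of_real (- (exp (- y) * y powr (s - 1)))) (at y)"
    by (rule has_vector_derivative_transform_within_open[where S = "{0<..}"])
       (use True in \<open>auto simp: inc_Gamma_pos\<close>)
  also have "complex_of_real (- (exp (- y) * y powr (s - 1))) = - (exp (- of_real y) * of_real y powr of_real (s - 1))"
    using complex_of_real_exp_powr[of y] True by simp
  finally show ?thesis .
next
  case False
  hence y: "y < 0" using assms by simp
  define f where "f = (\<lambda>t::complex. exp (- t) * t powr of_real (s - 1))"
  obtain \<Phi> where \<Phi>: "\<And>w. w \<noteq> 0 \<Longrightarrow> Im w \<ge> 0 \<Longrightarrow> (\<Phi> has_field_derivative f w) (at w)"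
    using exp_powr_primitive[of "s - 1"] unfolding f_def by blast
  have eq: "inc_Gamma s x = \<Phi> (of_real (- x)) - \<Phi> (of_real x) + of_real (exp_powr_tail (s - 1) (- x))" if "x < 0" for x
  proof -
    have "(f has_contour_integral (\<Phi> (pathfinish (part_circlepath 0 \<bar>x\<bar> pi 0)) - \<Phi> (pathstart (part_circlepath 0 \<bar>x\<bar> pi 0))))
       (part_circlepath 0 \<bar>x\<bar> pi 0)"
    proof (rule contour_integral_primitive)
      show "(\<Phi> has_field_derivative f w) (at w within {w. w \<noteq> 0 \<and> Im w \<ge> 0})" if "w \<in> {w. w \<noteq> 0 \<and> Im w \<ge> 0}" for w
        using \<Phi>[of w] that by (auto intro: has_field_derivative_at_within)
      show "path_image (part_circlepath 0 \<bar>x\<bar> pi 0) \<subseteq> {w. w \<noteq> 0 \<and> Im w \<ge> 0}"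
        using that unfolding path_image_part_circlepath'
        by (auto simp: closed_segment_eq_real_ivl intro!: mult_nonpos_nonneg sin_ge_zero)
    qed auto
    moreover have "of_real \<bar>x\<bar> * exp (\<i> * of_real pi) = complex_of_real x"
      using that by (simp add: exp_Euler)
    ultimately have "contour_integral (part_circlepath 0 \<bar>x\<bar> pi 0) f = \<Phi> (of_real (- x)) - \<Phi> (of_real x)"
      using that by (intro contour_integral_unique) (simp add: mult.commute)
    thus ?thesis
      using that by (simp add: inc_Gamma_def exp_powr_tail_def f_def)
  qed
  have 1: "((\<lambda>x. \<Phi> (of_real x)) has_vector_derivative f (of_real y)) (at y)"
    by (rule has_vector_derivative_real_field) (use \<Phi>[of "of_real y"] y in auto)
  have "(\<Phi> has_field_derivative f (of_real (- y))) (at (of_real (- y)))"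
    using \<Phi>[of "of_real (- y)"] y by auto
  hence "((\<lambda>w. \<Phi> (- w)) has_field_derivative f (of_real (- y)) * (- 1)) (at (of_real y))"
    by (intro DERIV_chain2[where f = \<Phi>]) (auto intro!: derivative_eq_intros)
  hence 2: "((\<lambda>x. \<Phi> (of_real (- x))) has_vector_derivative - f (of_real (- y))) (at y)"
    using has_vector_derivative_real_field[of "\<lambda>w. \<Phi> (- w)" "- f (of_real (- y))" y] by simp
  have "(exp_powr_tail (s - 1) has_real_derivative - (exp (- (- y)) * (- y) powr (s - 1))) (at (- y))"
    using y assms by (intro exp_powr_tail_has_real_derivative) auto
  hence "((\<lambda>x. exp_powr_tail (s - 1) (- x)) has_real_derivative - (exp (- (- y)) * (- y) powr (s - 1)) * - 1) (at y)"
    by (intro DERIV_chain2[where f = "exp_powr_tail (s - 1)"]) (auto intro!: derivative_eq_intros)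
  hence "((\<lambda>x. complex_of_real (exp_powr_tail (s - 1) (- x))) has_vector_derivative of_real (exp y * (- y) powr (s - 1))) (at y)"
    by (intro has_vector_derivative_of_real) (simp add: has_real_derivative_iff_has_vector_derivative)
  also have "complex_of_real (exp y * (- y) powr (s - 1)) = f (of_real (- y))"
    using complex_of_real_exp_powr[of "- y"] y by (simp add: f_def)
  finally have 3: "((\<lambda>x. complex_of_real (exp_powr_tail (s - 1) (- x))) has_vector_derivative f (of_real (- y))) (at y)" .
  have "((\<lambda>x. \<Phi> (of_real (- x)) - \<Phi> (of_real x) + of_real (exp_powr_tail (s - 1) (- x))) has_vector_derivative
          - f (of_real (- y)) - f (of_real y) + f (of_real (- y))) (at y)"
    by (intro has_vector_derivative_add has_vector_derivative_diff 1 2 3)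
  hence "(inc_Gamma s has_vector_derivative - f (of_real (- y)) - f (of_real y) + f (of_real (- y))) (at y)"
    by (rule has_vector_derivative_transform_within_open[where S = "{..<0}"]) (use y eq in auto)
  thus ?thesis by (simp add: f_def)
qed

subsection \<open>Derivatives of the Fourier expansion\<close>

lemma holomorphic_powser_ball:
  fixes a :: "nat \<Rightarrow> complex"
  assumes "\<And>q. norm q < 1 \<Longrightarrow> summable (\<lambda>k. a k * q ^ k)"
  shows "(\<lambda>q. \<Sum>k. a k * q ^ k) holomorphic_on ball 0 1"
proof (rule power_series_holomorphic[where a = a])
  show "(\<lambda>n. a n * (w - 0) ^ n) sums (\<Sum>k. a k * w ^ k)" if "w \<in> ball 0 1" for w
    using assms[of w] that by (simp add: summable_sums)
qed

lemma q_pow_add: "q_pow (r + s) z = q_pow r z * q_pow s z"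
  by (simp add: q_pow_def algebra_simps flip: exp_add)

lemma q_pow_1_surj:
  assumes "norm q < 1" "q \<noteq> 0"
  obtains z where "Im z > 0" "q = q_pow 1 z"
proof (rule that)
  define z where "z = Ln q / (2 * of_real pi * \<i>)"
  show qz: "q = q_pow 1 z" using assms by (simp add: q_pow_def z_def)
  have "exp (- 2 * pi * Im z) < 1" using assms norm_q_pow[of 1 z] qz by simp
  thus "Im z > 0" by (simp add: zero_less_mult_iff)
qed

text \<open>Every nonzero q in the unit disc is \<open>q_pow 1 z\<close> for some z in the upper
  half plane, so convergence at all z means convergence of the power series on the whole
  disc.\<close>

lemma holomorphic_q_series:
  assumes "\<And>z. Im z > 0 \<Longrightarrow> (\<lambda>k. a k * q_pow (r + real k) z) sums S z"
  obtains U where "U holomorphic_on ball 0 1" "\<And>z. Im z > 0 \<Longrightarrow> S z = q_pow r z * U (q_pow 1 z)"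
proof -
  have *: "(\<lambda>k. a k * q_pow 1 z ^ k) sums (S z / q_pow r z)" if "Im z > 0" for z
  proof -
    have "(\<lambda>k. a k * q_pow (r + real k) z / q_pow r z) sums (S z / q_pow r z)"
      using assms[OF that] by (rule sums_divide)
    moreover have "q_pow r z \<noteq> 0" by (simp add: q_pow_def)
    ultimately show ?thesis by (simp add: q_pow_add q_pow_eq_power)
  qed
  have "summable (\<lambda>k. a k * q ^ k)" if q: "norm q < 1" for q
  proof (cases "q = 0")
    case False
    with q obtain z where "Im z > 0" "q = q_pow 1 z" by (rule q_pow_1_surj)
    with * show ?thesis by (auto simp: sums_iff)
  qed (auto simp: powser_zero intro: summable_finite[of "{0}"])
  hence "(\<lambda>q. \<Sum>k. a k * q ^ k) holomorphic_on ball 0 1" by (rule holomorphic_powser_ball)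
  moreover have "S z = q_pow r z * (\<Sum>k. a k * q_pow 1 z ^ k)" if "Im z > 0" for z
    using *[OF that] by (simp add: sums_iff q_pow_def)
  ultimately show ?thesis using that by blast
qed

section \<open>Derivatives and growth of the nonholomorphic terms\<close>

text \<open>The power is the complex principal one, so that the same formula covers the negative
  argument of the term n = -1.\<close>

definition \<beta>_deriv :: "real \<Rightarrow> complex" where
  "\<beta>_deriv t = - (of_real (pi / 6) * exp (- of_real (pi * t / 6)) * of_real (pi * t / 6) powr (- 5 / 2))"

lemma \<beta>_has_vector_derivative:
  assumes "t \<noteq> 0"
  shows "(\<beta> has_vector_derivative \<beta>_deriv t) (at t)"
proof -
  have "(inc_Gamma (- 3 / 2) has_vector_derivative
      - (exp (- of_real (pi * t / 6)) * of_real (pi * t / 6) powr of_real (- 3 / 2 - 1))) (at (pi * t / 6))"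
    using assms by (intro inc_Gamma_has_vector_derivative) auto
  moreover have "((\<lambda>t. pi * t / 6) has_vector_derivative pi / 6) (at t)"
    by (auto intro!: derivative_eq_intros simp flip: has_real_derivative_iff_has_vector_derivative)
  ultimately have "(inc_Gamma (- 3 / 2) \<circ> (\<lambda>t. pi * t / 6) has_vector_derivative
      (pi / 6) *\<^sub>R (- (exp (- of_real (pi * t / 6)) * of_real (pi * t / 6) powr of_real (- 3 / 2 - 1)))) (at t)"
    by (intro vector_diff_chain_at)
  thus ?thesis
    unfolding \<beta>_def[abs_def] \<beta>_deriv_def by (simp add: o_def scaleR_conv_of_real mult.assoc)
qed

lemma \<beta>_q_pow_has_derivative:
  assumes "n \<noteq> 0" "Im z > 0"
  defines "B \<equiv> \<i> / 2 * of_real n * \<beta>_deriv (n * Im z) * q_pow (- n / 24) z"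
  defines "C \<equiv> - \<i> * of_real (pi * n / 12) * \<beta> (n * Im z) * q_pow (- n / 24) z"
  shows "((\<lambda>z. \<beta> (n * Im z) * q_pow (- n / 24) z) has_derivative (\<lambda>v. (C - B) * v + B * cnj v)) (at z)"
proof -
  have "((\<lambda>z. n * Im z) has_derivative (\<lambda>v. n * Im v)) (at z)"
    by (intro derivative_intros)
  moreover have "(\<beta> has_derivative (\<lambda>x. x *\<^sub>R \<beta>_deriv (n * Im z))) (at (n * Im z))"
    using \<beta>_has_vector_derivative[of "n * Im z"] assms by (simp add: has_vector_derivative_def)
  ultimately have 1: "((\<lambda>z. \<beta> (n * Im z)) has_derivative (\<lambda>v. (n * Im v) *\<^sub>R \<beta>_deriv (n * Im z))) (at z)"
    by (rule has_derivative_compose)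
  have "(q_pow (- n / 24) has_field_derivative - \<i> * of_real (pi * n / 12) * q_pow (- n / 24) z) (at z)"
    unfolding q_pow_def by (auto intro!: derivative_eq_intros)
  hence 2: "(q_pow (- n / 24) has_derivative (\<lambda>v. - \<i> * of_real (pi * n / 12) * q_pow (- n / 24) z * v)) (at z)"
    by (simp only: has_field_derivative_def)
  have "((\<lambda>z. \<beta> (n * Im z) * q_pow (- n / 24) z) has_derivative
      (\<lambda>v. \<beta> (n * Im z) * (- \<i> * of_real (pi * n / 12) * q_pow (- n / 24) z * v) +
           ((n * Im v) *\<^sub>R \<beta>_deriv (n * Im z)) * q_pow (- n / 24) z)) (at z)"
    by (rule has_derivative_mult[OF 1 2])
  moreover have "\<beta> (n * Im z) * (- \<i> * of_real (pi * n / 12) * q_pow (- n / 24) z * v) +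
      ((n * Im v) *\<^sub>R \<beta>_deriv (n * Im z)) * q_pow (- n / 24) z = (C - B) * v + B * cnj v" for v
  proof -
    \<comment> \<open>This puts the derivative of \<beta> into both Wirtinger components with
      opposite signs, hence \<open>C - B\<close> and \<open>B\<close>; the holomorphic factor
      contributes only \<open>C\<close>.\<close>
    have im: "complex_of_real (Im v) = - \<i> / 2 * (v - cnj v)"
      by (simp add: complex_eq_iff)
    show ?thesis
      unfolding B_def C_def scaleR_conv_of_real of_real_mult im by (simp add: field_simps)
  qed
  ultimately show ?thesis by simp
qed

lemma \<beta>_bounds:
  assumes "t > 0"
  shows "norm (\<beta> t) \<ge> exp (- (pi * t / 6 + 1)) * (pi * t / 6 + 1) powr (- 5 / 2)"
    and "norm (\<beta> t) \<le> exp (- (pi * t / 6)) * (pi * t / 6) powr (- 5 / 2)"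
proof -
  have y: "pi * t / 6 > 0" using assms by simp
  have b: "\<beta> t = of_real (exp_powr_tail (- 5 / 2) (pi * t / 6))"
    using inc_Gamma_pos[OF y, of "- 3 / 2"] by (simp add: \<beta>_def)
  have 1: "exp_powr_tail (- 5 / 2) (pi * t / 6) \<ge> exp (- (pi * t / 6 + 1)) * (pi * t / 6 + 1) powr (- 5 / 2)"
    by (rule exp_powr_tail_lower) (use y in auto)
  have 2: "exp_powr_tail (- 5 / 2) (pi * t / 6) \<le> exp (- (pi * t / 6)) * (pi * t / 6) powr (- 5 / 2)"
    by (rule exp_powr_tail_upper) (use y in auto)
  have "exp (- (pi * t / 6 + 1)) * (pi * t / 6 + 1) powr (- 5 / 2) \<ge> 0" by simp
  hence "exp_powr_tail (- 5 / 2) (pi * t / 6) \<ge> 0"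
    using 1 by (rule order_trans)
  hence 3: "norm (\<beta> t) = exp_powr_tail (- 5 / 2) (pi * t / 6)"
    unfolding b by simp
  show "norm (\<beta> t) \<ge> exp (- (pi * t / 6 + 1)) * (pi * t / 6 + 1) powr (- 5 / 2)"
    and "norm (\<beta> t) \<le> exp (- (pi * t / 6)) * (pi * t / 6) powr (- 5 / 2)"
    unfolding 3 by (fact 1 2)+
qed

lemma norm_\<beta>_deriv:
  assumes "t > 0"
  shows "norm (\<beta>_deriv t) = pi / 6 * (exp (- (pi * t / 6)) * (pi * t / 6) powr (- 5 / 2))"
proof -
  have "norm (of_real (pi * t / 6) powr (- 5 / 2 :: complex)) = (pi * t / 6) powr (- 5 / 2)"
    using assms by (subst norm_powr_real_powr') (auto simp: norm_mult)
  moreover have "norm (exp (- complex_of_real (pi * t / 6))) = exp (- (pi * t / 6))"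
    by (simp add: norm_exp_eq_Re)
  ultimately show ?thesis
    by (simp only: \<beta>_deriv_def norm_minus_cancel norm_mult norm_of_real) simp
qed

text \<open>At height y the k-th term has size about norm (m k) * exp(-2 pi k y), up to powers of k,
  by the lower bound for \<beta>. Convergence at every height thus forces subexponential growth of m
  in the averaged sense stated.\<close>

lemma summable_coeffs:
  fixes m :: "nat \<Rightarrow> complex"
  assumes "\<And>z. Im z > 0 \<Longrightarrow> summable (\<lambda>k. norm (m k * \<beta> ((24 * real k + 23) * Im z) * q_pow (- (24 * real k + 23) / 24) z))"
    and x: "0 < x" "x < 1"
  shows "summable (\<lambda>k. norm (m k) * (24 * real k + 23) * x ^ k)"
proof -
  \<comment> \<open>With this y, x = exp(-4 pi y), which leaves a spare factor of about exp(-2 pi k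
    y) to absorb all powers of k.\<close>
  define y where "y = - ln x / (4 * pi)"
  have y: "y > 0" using x by (simp add: y_def divide_neg_pos)
  define w where "w = (\<lambda>k. pi * ((24 * real k + 23) * y) / 6)"
  have "summable (\<lambda>k. norm (m k * \<beta> ((24 * real k + 23) * y) * q_pow (- (24 * real k + 23) / 24) (\<i> * of_real y)))"
    using assms(1)[of "\<i> * of_real y"] y by simp
  thus ?thesis
  proof (rule summable_comparison_test_ev[rotated])
    have "((\<lambda>k. (24 * real k + 23) * exp (- 4 * pi * y * k) / (exp (- (w k + 1)) * (w k + 1) powr (- 5 / 2) * exp (w k / 2))) \<longlongrightarrow> 0) sequentially"
      unfolding w_def using y by real_asymp
    hence "\<forall>\<^sub>F k in sequentially. (24 * real k + 23) * exp (- 4 * pi * y * k) / (exp (- (w k + 1)) * (w k + 1) powr (- 5 / 2) * exp (w k / 2)) < 1"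
      by (rule order_tendstoD) simp
    thus "\<forall>\<^sub>F k in sequentially. norm (norm (m k) * (24 * real k + 23) * x ^ k) \<le>
        norm (m k * \<beta> ((24 * real k + 23) * y) * q_pow (- (24 * real k + 23) / 24) (\<i> * of_real y))"
    proof eventually_elim
      case (elim k)
      have w0: "w k > 0" using y by (auto simp: w_def intro!: mult_pos_pos add_nonneg_pos)
      have xk: "x ^ k = exp (- 4 * pi * y * k)"
      proof -
        have "exp (- 4 * pi * y * k) = exp (real k * ln x)" by (simp add: y_def mult.commute)
        thus ?thesis using x by (simp add: exp_of_nat_mult)
      qed
      have "(24 * real k + 23) * x ^ k \<le> exp (- (w k + 1)) * (w k + 1) powr (- 5 / 2) * exp (w k / 2)"
        using elim w0 unfolding xk by (subst (asm) pos_divide_less_eq) auto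
      also have "\<dots> \<le> norm (\<beta> ((24 * real k + 23) * y)) * exp (w k / 2)"
        using \<beta>_bounds(1)[of "(24 * real k + 23) * y"] y
        by (intro mult_right_mono) (auto simp: w_def)
      also have "exp (w k / 2) = norm (q_pow (- (24 * real k + 23) / 24) (\<i> * of_real y))"
        by (simp add: norm_q_pow w_def field_simps)
      finally have "norm (m k) * ((24 * real k + 23) * x ^ k) \<le> norm (m k) * (norm (\<beta> ((24 * real k + 23) * y)) * norm (q_pow (- (24 * real k + 23) / 24) (\<i> * of_real y)))"
        by (intro mult_left_mono) auto
      thus ?case using x by (simp add: norm_mult abs_mult mult.assoc)
    qed
  qed
qed


text \<open>The factor exp(-pi n y/6) from the derivative of \<beta> completes q^(-n/24) to the
  conjugate of q^(n/24). The powers separate, so that y enters through one factor common to all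
  n.\<close>

lemma \<beta>_deriv_q_pow_pos:
  assumes "n > 0" "Im z > 0"
  shows "\<i> / 2 * of_real n * \<beta>_deriv (n * Im z) * q_pow (- n / 24) z =
     - \<i> / 2 * of_real ((pi / 6) powr (- 3 / 2) * Im z powr (- 5 / 2)) * of_real (n powr (- 3 / 2)) * cnj (q_pow (n / 24) z)"
proof -
  define y where "y = Im z"
  have y: "y > 0" using assms by (simp add: y_def)
  have e: "exp (- of_real (pi * (n * y) / 6)) * q_pow (- n / 24) z = cnj (q_pow (n / 24) z)"
  proof -
    have "- of_real (pi * (n * y) / 6) + 2 * of_real pi * \<i> * of_real (- n / 24) * z = cnj (2 * of_real pi * \<i> * of_real (n / 24) * z)"
      by (simp add: complex_eq_iff y_def field_simps)
    thus ?thesis unfolding q_pow_def by (simp only: exp_add[symmetric] exp_cnj)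
  qed
  have "pi / 6 * n * (pi * (n * y) / 6) powr (- 5 / 2) = (pi / 6) powr 1 * n powr 1 * ((pi / 6) powr (- 5 / 2) * n powr (- 5 / 2) * y powr (- 5 / 2))"
    using assms y by (simp add: powr_mult[symmetric] mult_ac)
  also have "\<dots> = ((pi / 6) powr 1 * (pi / 6) powr (- 5 / 2)) * (n powr 1 * n powr (- 5 / 2)) * y powr (- 5 / 2)"
    by (simp only: mult_ac)
  also have "\<dots> = (pi / 6) powr (- 3 / 2) * n powr (- 3 / 2) * y powr (- 5 / 2)"
    unfolding powr_add[symmetric] by simp
  finally have r: "pi / 6 * n * (pi * (n * y) / 6) powr (- 5 / 2) = (pi / 6) powr (- 3 / 2) * n powr (- 3 / 2) * y powr (- 5 / 2)" .
  have "of_real (pi * (n * y) / 6) powr (- 5 / 2 :: complex) = of_real ((pi * (n * y) / 6) powr (- 5 / 2))"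
    using assms y powr_of_real[of "pi * (n * y) / 6" "- 5 / 2"] by simp
  hence "\<i> / 2 * of_real n * \<beta>_deriv (n * y) * q_pow (- n / 24) z =
      - \<i> / 2 * of_real (pi / 6 * n * (pi * (n * y) / 6) powr (- 5 / 2)) * (exp (- of_real (pi * (n * y) / 6)) * q_pow (- n / 24) z)"
    by (simp add: \<beta>_deriv_def mult_ac)
  thus ?thesis unfolding r e by (simp add: y_def mult_ac)
qed

text \<open>On the negative axis the argument is pi, so the power -5/2 contributes exp(-5 pi i/2) =
  -i. After multiplication by the i in \<open>h1\<close> the constant is the same i/2 as in the
  derivation of the other terms, with opposite sign.\<close>

lemma \<beta>_deriv_q_pow_minus_1:
  assumes "Im z > 0"
  shows "\<i> / 2 * of_real (- 1) * \<beta>_deriv (- 1 * Im z) * q_pow (- (- 1) / 24) z =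
     1 / 2 * of_real ((pi / 6) powr (- 3 / 2) * Im z powr (- 5 / 2)) * cnj (q_pow (- 1 / 24) z)"
proof -
  define y where "y = Im z"
  have y: "y > 0" using assms by (simp add: y_def)
  have e: "exp (of_real (pi * y / 6)) * q_pow (1 / 24) z = cnj (q_pow (- 1 / 24) z)"
  proof -
    have "of_real (pi * y / 6) + 2 * of_real pi * \<i> * of_real (1 / 24) * z = cnj (2 * of_real pi * \<i> * of_real (- 1 / 24) * z)"
      by (simp add: complex_eq_iff y_def field_simps)
    thus ?thesis unfolding q_pow_def by (simp only: exp_add[symmetric] exp_cnj)
  qed
  have "pi / 6 * (pi * y / 6) powr (- 5 / 2) = (pi / 6) powr 1 * ((pi / 6) powr (- 5 / 2) * y powr (- 5 / 2))"
    using y by (simp add: powr_mult[symmetric])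
  also have "\<dots> = (pi / 6) powr (- 3 / 2) * y powr (- 5 / 2)"
    unfolding mult.assoc[symmetric] powr_add[symmetric] by simp
  finally have r: "pi / 6 * (pi * y / 6) powr (- 5 / 2) = (pi / 6) powr (- 3 / 2) * y powr (- 5 / 2)" .
  have p: "of_real (- (pi * y / 6)) powr (- 5 / 2 :: complex) = - \<i> * of_real ((pi * y / 6) powr (- 5 / 2))"
  proof -
    define t where "t = pi * y / 6"
    have t: "t > 0" using y by (simp add: t_def)
    have "of_real (- t) powr (- 5 / 2 :: complex) = exp (- 5 / 2 * Ln (of_real (- t)))"
      using t by (simp add: powr_def)
    also have "Ln (of_real (- t)) = of_real (ln t) + \<i> * of_real pi"
      using t Ln_minus[of "of_real t"] by (simp add: Ln_of_real)
    also have "exp (- 5 / 2 * (of_real (ln t) + \<i> * of_real pi)) = exp (of_real (- 5 / 2 * ln t)) * exp (- (5 / 2 * of_real pi) * \<i>)"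
      unfolding exp_add[symmetric] by (rule arg_cong[where f = exp]) (simp add: field_simps)
    also have "exp (of_real (- 5 / 2 * ln t)) = complex_of_real (t powr (- 5 / 2))"
      using t by (simp only: exp_of_real powr_def) simp
    also have "exp (- (5 / 2 * of_real pi) * \<i>) = - \<i>"
    proof -
      have "- (5 / 2 * of_real pi) * \<i> = \<i> * of_real (- (pi / 2) - 2 * pi)" by simp
      hence "exp (- (5 / 2 * of_real pi) * \<i>) = cis (- (pi / 2) - 2 * pi)" by (simp only: cis_conv_exp)
      also have "\<dots> = cis (- (pi / 2)) * cis (- (2 * pi))" unfolding cis_mult by simp
      also have "\<dots> = - \<i>" by (simp add: complex_eq_iff)
      finally show ?thesis .
    qed
    finally show ?thesis by (simp add: t_def)
  qed
  have "\<beta>_deriv (- y) = \<i> * of_real (pi / 6 * (pi * y / 6) powr (- 5 / 2)) * exp (of_real (pi * y / 6))"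
    using p by (simp add: \<beta>_deriv_def mult_ac)
  moreover have "\<i> / 2 * of_real (- 1) * (\<i> * a * E) * Q = 1 / 2 * a * (E * Q)" for a E Q :: complex
    by (simp add: mult.assoc)
  ultimately have "\<i> / 2 * of_real (- 1) * \<beta>_deriv (- 1 * y) * q_pow (- (- 1) / 24) z =
      1 / 2 * of_real (pi / 6 * (pi * y / 6) powr (- 5 / 2)) * (exp (of_real (pi * y / 6)) * q_pow (1 / 24) z)"
    by (simp only: minus_minus mult_minus1)
  thus ?thesis unfolding r e by (simp add: y_def)
qed

text \<open>
  A real differentiable \<open>f\<close> has derivative \<open>v \<mapsto> A v + B (cnj v)\<close> with
  \<open>B\<close> the Wirtinger derivative with respect to \<open>cnj z\<close>.
\<close>

lemma nonholomorphic_part_has_derivative: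
  fixes m :: "nat \<Rightarrow> complex"
  defines "N \<equiv> \<lambda>k. 24 * real k + 23"
  assumes sums: "\<And>z. Im z > 0 \<Longrightarrow> (\<lambda>k. m k * \<beta> (N k * Im z) * q_pow (- N k / 24) z) sums T z"
    and coeffs: "\<And>x. 0 < x \<Longrightarrow> x < 1 \<Longrightarrow> summable (\<lambda>k. norm (m k) * N k * x ^ k)"
    and z: "Im z > 0"
  shows "summable (\<lambda>k. m k * (\<i> / 2 * of_real (N k) * \<beta>_deriv (N k * Im z) * q_pow (- N k / 24) z))"
    and "\<exists>A. (T has_derivative (\<lambda>v. A * v +
      (\<Sum>k. m k * (\<i> / 2 * of_real (N k) * \<beta>_deriv (N k * Im z) * q_pow (- N k / 24) z)) * cnj v)) (at z)"
proof -
  define B where "B = (\<lambda>k z. \<i> / 2 * of_real (N k) * \<beta>_deriv (N k * Im z) * q_pow (- N k / 24) z)"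
  define C where "C = (\<lambda>k z. - \<i> * of_real (pi * N k / 12) * \<beta> (N k * Im z) * q_pow (- N k / 24) z)"
  have N: "N k \<ge> 1" for k by (simp add: N_def)
  \<comment> \<open>Uniform bounds hold on the half plane above Im z / 2, an open convex
    neighbourhood of z.\<close>
  define y0 where "y0 = Im z / 2"
  have y0: "y0 > 0" using z by (simp add: y0_def)
  define x where "x = exp (- 2 * pi * y0)"
  have x: "0 < x" "x < 1" using y0 by (auto simp: x_def)
  define S where "S = {w. Im w > y0}"
  have S: "convex S" "open S"
    unfolding S_def by (rule convex_halfspace_Im_gt open_halfspace_Im_gt)+
  have zS: "z \<in> S" using z by (simp add: S_def y0_def)
  define c where "c = (pi * y0 / 6) powr (- 5 / 2)"
  define M where "M = (\<lambda>k. c * (norm (m k) * N k * x ^ k))"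
  have M: "summable M" unfolding M_def by (intro summable_mult coeffs x)
  have main: "norm (\<beta> (N k * Im w) * q_pow (- N k / 24) w) \<le> c * x ^ k"
    "norm (\<beta>_deriv (N k * Im w) * q_pow (- N k / 24) w) \<le> pi / 6 * (c * x ^ k)" if w: "w \<in> S" for k w
  proof -
    define t where "t = pi * (N k * Im w) / 6"
    have Imw: "Im w > y0" using w by (simp add: S_def)
    have ny: "N k * Im w > 0" using N[of k] Imw y0 by (intro mult_pos_pos) auto
    have "1 * y0 \<le> N k * Im w" using N[of k] Imw y0 by (intro mult_mono) auto
    hence "t \<ge> pi * y0 / 6" unfolding t_def by (intro divide_right_mono mult_left_mono) auto
    hence tc: "t powr (- 5 / 2) \<le> c" unfolding c_def using y0 by (intro powr_mono2') auto
    have q: "norm (q_pow (- N k / 24) w) = exp (t / 2)" by (simp add: norm_q_pow t_def)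
    \<comment> \<open>Since N k / 24 is at least k, half of the exponent t already yields the
      geometric factor x^k.\<close>
    have "real k * y0 \<le> N k / 24 * Im w" using Imw y0 by (intro mult_mono) (auto simp: N_def)
    hence "2 * pi * (real k * y0) \<le> 2 * pi * (N k / 24 * Im w)" by (intro mult_left_mono) auto
    hence "exp (- (t / 2)) \<le> exp (real k * (- 2 * pi * y0))" by (simp add: t_def mult_ac)
    also have "\<dots> = x ^ k" by (simp only: x_def exp_of_nat_mult)
    finally have xk: "exp (- (t / 2)) \<le> x ^ k" .
    have e: "exp (- t) * exp (t / 2) = exp (- (t / 2))" by (simp flip: exp_add)
    have ex: "exp (- t) * t powr (- 5 / 2) * exp (t / 2) \<le> c * x ^ k"
    proof -
      have "exp (- t) * t powr (- 5 / 2) * exp (t / 2) = t powr (- 5 / 2) * exp (- (t / 2))"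
        unfolding e[symmetric] by (simp only: mult_ac)
      also have "\<dots> \<le> c * x ^ k" using tc xk by (intro mult_mono) (auto simp: c_def)
      finally show ?thesis .
    qed
    have "norm (\<beta> (N k * Im w)) * norm (q_pow (- N k / 24) w) \<le> exp (- t) * t powr (- 5 / 2) * exp (t / 2)"
      unfolding q using \<beta>_bounds(2)[OF ny] by (intro mult_right_mono) (auto simp: t_def)
    with ex show "norm (\<beta> (N k * Im w) * q_pow (- N k / 24) w) \<le> c * x ^ k"
      by (simp add: norm_mult)
    have "norm (\<beta>_deriv (N k * Im w) * q_pow (- N k / 24) w) = pi / 6 * (exp (- t) * t powr (- 5 / 2) * exp (t / 2))"
      unfolding norm_mult norm_\<beta>_deriv[OF ny] q by (simp add: t_def)
    also have "\<dots> \<le> pi / 6 * (c * x ^ k)" using ex by (intro mult_left_mono) auto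
    finally show "norm (\<beta>_deriv (N k * Im w) * q_pow (- N k / 24) w) \<le> pi / 6 * (c * x ^ k)" .
  qed
  have Bb: "norm (m k * B k w) \<le> M k" if w: "w \<in> S" for k w
  proof -
    have "norm (m k * B k w) = norm (m k) * N k / 2 * norm (\<beta>_deriv (N k * Im w) * q_pow (- N k / 24) w)"
      using N[of k] by (simp add: B_def norm_mult)
    also have "\<dots> \<le> norm (m k) * N k / 2 * (pi / 6 * (c * x ^ k))"
      using N[of k] by (intro mult_left_mono main w) auto
    also have "\<dots> = pi / 12 * M k" by (simp add: M_def)
    also have "\<dots> \<le> 1 * M k"
      using pi_less_4 N[of k] x by (intro mult_right_mono) (auto simp: M_def c_def)
    finally show ?thesis by simp
  qed
  have Cb: "norm (m k * C k w) \<le> M k" if w: "w \<in> S" for k w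
  proof -
    have "norm (m k * C k w) = norm (m k) * N k * pi / 12 * norm (\<beta> (N k * Im w) * q_pow (- N k / 24) w)"
      using N[of k] by (simp add: C_def norm_mult)
    also have "\<dots> \<le> norm (m k) * N k * pi / 12 * (c * x ^ k)"
      using N[of k] by (intro mult_left_mono main w) auto
    also have "\<dots> = pi / 12 * M k" by (simp add: M_def)
    also have "\<dots> \<le> 1 * M k"
      using pi_less_4 N[of k] x by (intro mult_right_mono) (auto simp: M_def c_def)
    finally show ?thesis by simp
  qed
  have sB: "summable (\<lambda>k. m k * B k w)" if "w \<in> S" for w
    using Bb[OF that] by (auto intro: summable_comparison_test'[OF M])
  have uB: "uniform_limit S (\<lambda>n w. \<Sum>k<n. m k * B k w) (\<lambda>w. \<Sum>k. m k * B k w) sequentially"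
    by (rule Weierstrass_m_test[OF Bb M])
  have uC: "uniform_limit S (\<lambda>n w. \<Sum>k<n. m k * C k w) (\<lambda>w. \<Sum>k. m k * C k w) sequentially"
    by (rule Weierstrass_m_test[OF Cb M])
  define B' where "B' = (\<lambda>w. \<Sum>k. m k * B k w)"
  define C' where "C' = (\<lambda>w. \<Sum>k. m k * C k w)"
  show "summable (\<lambda>k. m k * (\<i> / 2 * of_real (N k) * \<beta>_deriv (N k * Im z) * q_pow (- N k / 24) z))"
    using sB[OF zS] by (simp add: B_def)
  have "\<exists>g. \<forall>w\<in>S. (\<lambda>k. m k * \<beta> (N k * Im w) * q_pow (- N k / 24) w) sums g w \<and>
      (g has_derivative (\<lambda>v. (C' w - B' w) * v + B' w * cnj v)) (at w within S)"
  proof (rule has_derivative_series[OF S(1)])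
    show "((\<lambda>w. m k * \<beta> (N k * Im w) * q_pow (- N k / 24) w) has_derivative
        (\<lambda>v. m k * ((C k w - B k w) * v + B k w * cnj v))) (at w within S)" if "w \<in> S" for k w
    proof -
      have "((\<lambda>z. \<beta> (N k * Im z) * q_pow (- N k / 24) z) has_derivative (\<lambda>v. (C k w - B k w) * v + B k w * cnj v)) (at w)"
        unfolding B_def C_def by (rule \<beta>_q_pow_has_derivative) (use N[of k] that y0 in \<open>auto simp: S_def\<close>)
      from has_derivative_mult_right[OF has_derivative_at_withinI[OF this], of "m k" S] show ?thesis by (simp only: mult.assoc)
    qed
    show "(\<lambda>k. m k * \<beta> (N k * Im z) * q_pow (- N k / 24) z) sums T z" by (rule sums[OF z])
    fix e :: real assume e: "e > 0"
    from uniform_limitD[OF uB, of "e / 3"] uniform_limitD[OF uC, of "e / 3"] e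
    have "\<forall>\<^sub>F n in sequentially. (\<forall>w\<in>S. dist (\<Sum>k<n. m k * B k w) (B' w) < e / 3) \<and>
        (\<forall>w\<in>S. dist (\<Sum>k<n. m k * C k w) (C' w) < e / 3)"
      by (simp add: B'_def C'_def eventually_conj_iff)
    thus "\<forall>\<^sub>F n in sequentially. \<forall>w\<in>S. \<forall>v. norm ((\<Sum>k<n. m k * ((C k w - B k w) * v + B k w * cnj v)) -
        ((C' w - B' w) * v + B' w * cnj v)) \<le> e * norm v"
    proof eventually_elim
      case (elim n)
      show ?case
      proof (intro ballI allI)
        fix w v :: complex assume w: "w \<in> S"
        define b where "b = (\<Sum>k<n. m k * B k w) - B' w"
        define d where "d = (\<Sum>k<n. m k * C k w) - C' w"
        have "norm b \<le> e / 3" "norm d \<le> e / 3" using elim w by (auto simp: b_def d_def dist_norm less_imp_le)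
        hence "norm d * norm v \<le> e / 3 * norm v" "norm b * norm v \<le> e / 3 * norm v"
          by (auto intro: mult_right_mono simp del: times_divide_eq_left)
        hence "norm (d * v) \<le> e / 3 * norm v" "norm (b * v) \<le> e / 3 * norm v" "norm (b * cnj v) \<le> e / 3 * norm v"
          by (simp_all only: norm_mult complex_mod_cnj)
        hence "norm (d * v - b * v + b * cnj v) \<le> e / 3 * norm v + e / 3 * norm v + e / 3 * norm v"
          by (intro norm_triangle_mono norm_triangle_le_diff) auto
        moreover have "(\<Sum>k<n. m k * ((C k w - B k w) * v + B k w * cnj v)) - ((C' w - B' w) * v + B' w * cnj v)
           = d * v - b * v + b * cnj v"
          by (simp add: b_def d_def sum_distrib_left sum_distrib_right algebra_simps sum.distrib sum_subtractf)
        ultimately show "norm ((\<Sum>k<n. m k * ((C k w - B k w) * v + B k w * cnj v)) -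
            ((C' w - B' w) * v + B' w * cnj v)) \<le> e * norm v"
          by simp
      qed
    qed
  qed (use S zS in auto)
  then obtain g where g: "\<And>w. w \<in> S \<Longrightarrow> (\<lambda>k. m k * \<beta> (N k * Im w) * q_pow (- N k / 24) w) sums g w"
      "\<And>w. w \<in> S \<Longrightarrow> (g has_derivative (\<lambda>v. (C' w - B' w) * v + B' w * cnj v)) (at w within S)"
    by blast
  \<comment> \<open>Termwise differentiation provides only some limit function; uniqueness of sums
    identifies it with T.\<close>
  have "g w = T w" if "w \<in> S" for w
    using g(1)[OF that] sums[of w] that y0 sums_unique2 by (fastforce simp: S_def)
  moreover have "(g has_derivative (\<lambda>v. (C' z - B' z) * v + B' z * cnj v)) (at z)"
    using g(2)[OF zS] S by (simp add: at_within_open[of z S] zS)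
  ultimately have "(T has_derivative (\<lambda>v. (C' z - B' z) * v + B' z * cnj v)) (at z)"
    using has_derivative_transform_within_open[of g _ z UNIV S T] S zS by auto
  thus "\<exists>A. (T has_derivative (\<lambda>v. A * v +
      (\<Sum>k. m k * (\<i> / 2 * of_real (N k) * \<beta>_deriv (N k * Im z) * q_pow (- N k / 24) z)) * cnj v)) (at z)"
    by (auto simp: B'_def B_def)
qed

subsection \<open>Partitions\<close>

text \<open>With parts bounded by m the generating function is a finite product, so Euler's identity
  can be proved by induction on m before passing to the limit.\<close>

definition bounded_partitions :: "nat \<Rightarrow> nat \<Rightarrow> nat multiset set" where
  "bounded_partitions m n = {M. set_mset M \<subseteq> {1..m} \<and> \<Sum>\<^sub># M = n}"

lemma bounded_partitions_0: "bounded_partitions 0 n = (if n = 0 then {{#}} else {})"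
  by (auto simp: bounded_partitions_def)

text \<open>Either the part m + 1 does not occur, or one copy of it can be removed.\<close>

lemma bounded_partitions_Suc:
  "bounded_partitions (Suc m) n = bounded_partitions m n \<union>
     (if Suc m \<le> n then add_mset (Suc m) ` bounded_partitions (Suc m) (n - Suc m) else {})"
proof (intro Set.equalityI subsetI)
  fix M assume M: "M \<in> bounded_partitions (Suc m) n"
  show "M \<in> bounded_partitions m n \<union>
     (if Suc m \<le> n then add_mset (Suc m) ` bounded_partitions (Suc m) (n - Suc m) else {})"
  proof (cases "Suc m \<in># M")
    case True
    then obtain M' where M': "M = add_mset (Suc m) M'" by (metis mset_add)
    with M have "Suc m \<le> n" "M' \<in> bounded_partitions (Suc m) (n - Suc m)"
      by (auto simp: bounded_partitions_def)
    with M' show ?thesis by auto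
  next
    case False
    with M show ?thesis by (fastforce simp: bounded_partitions_def le_Suc_eq)
  qed
next
  fix M assume "M \<in> bounded_partitions m n \<union>
     (if Suc m \<le> n then add_mset (Suc m) ` bounded_partitions (Suc m) (n - Suc m) else {})"
  thus "M \<in> bounded_partitions (Suc m) n"
    by (fastforce simp: bounded_partitions_def split: if_splits)
qed

text \<open>The recursion either lowers m or keeps m and lowers n, hence the nested
  induction.\<close>

lemma finite_bounded_partitions: "finite (bounded_partitions m n)"
proof (induction m arbitrary: n)
  case 0
  show ?case by (simp add: bounded_partitions_0)
next
  case (Suc m)
  show ?case
  proof (induction n rule: less_induct)
    case (less n)
    show ?case by (subst bounded_partitions_Suc) (use Suc less in auto)
  qed
qed

lemma card_bounded_partitions_Suc:
  "card (bounded_partitions (Suc m) n) = card (bounded_partitions m n) +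
     (if Suc m \<le> n then card (bounded_partitions (Suc m) (n - Suc m)) else 0)"
proof -
  have "bounded_partitions m n \<inter> add_mset (Suc m) ` X = {}" for X
    by (fastforce simp: bounded_partitions_def)
  thus ?thesis
    by (subst bounded_partitions_Suc)
       (auto simp: card_Un_disjoint finite_bounded_partitions card_image inj_on_def)
qed

lemma partition_set_eq_bounded_partitions:
  assumes "n \<le> m"
  shows "{M :: nat multiset. 0 \<notin># M \<and> \<Sum>\<^sub># M = n} = bounded_partitions m n"
proof -
  have "k \<le> \<Sum>\<^sub># M" if "k \<in># M" for k and M :: "nat multiset"
    using that by (metis le_add1 mset_add sum_mset.add_mset)
  thus ?thesis
    using assms unfolding bounded_partitions_def
    by (fastforce simp: Suc_le_eq intro: Nat.gr0I)
qed

lemma partition_number_eq_card: "n \<le> m \<Longrightarrow> partition_number n = card (bounded_partitions m n)"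
  by (simp add: partition_number_def partition_set_eq_bounded_partitions)

lemma card_bounded_partitions_le: "card (bounded_partitions m n) \<le> partition_number n"
proof -
  have "bounded_partitions m n \<subseteq> bounded_partitions (max m n) n"
    by (fastforce simp: bounded_partitions_def)
  hence "card (bounded_partitions m n) \<le> card (bounded_partitions (max m n) n)"
    by (intro card_mono finite_bounded_partitions)
  thus ?thesis using partition_number_eq_card[of n "max m n"] by simp
qed

text \<open>A truncated Euler identity, usable before convergence is known. Truncation drops
  nonnegative terms of the shifted sum, so an inequality survives.\<close>

lemma bounded_partitions_partial_sums:
  fixes x :: real
  assumes x: "0 \<le> x" "x < 1"
  shows "(\<Sum>n<N. real (card (bounded_partitions m n)) * x ^ n) \<le> inverse (\<Prod>k<m. 1 - x ^ Suc k)"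
proof (induction m)
  case 0
  have "(\<Sum>n<N. real (card (bounded_partitions 0 n)) * x ^ n) = (\<Sum>n<N. if n = 0 then 1 else 0)"
    by (intro sum.cong) (auto simp: bounded_partitions_0)
  thus ?case by simp
next
  case (Suc m)
  define g where "g = (\<lambda>n. real (card (bounded_partitions (Suc m) n)) * x ^ n)"
  have g0: "g n \<ge> 0" for n using x by (simp add: g_def)
  have lt: "x ^ Suc m < 1"
    using x power_decreasing[of 1 "Suc m" x] by simp
  have "(\<Sum>n<N. g n) = (\<Sum>n<N. real (card (bounded_partitions m n)) * x ^ n) +
      (\<Sum>n<N. if Suc m \<le> n then x ^ Suc m * g (n - Suc m) else 0)"
    unfolding sum.distrib[symmetric]
  proof (rule sum.cong, rule refl)
    fix n
    have "x ^ n = x ^ Suc m * x ^ (n - Suc m)" if "Suc m \<le> n"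
      using that by (metis le_add_diff_inverse power_add)
    thus "g n = real (card (bounded_partitions m n)) * x ^ n + (if Suc m \<le> n then x ^ Suc m * g (n - Suc m) else 0)"
      unfolding g_def by (subst card_bounded_partitions_Suc) (auto simp: algebra_simps)
  qed
  also have "(\<Sum>n<N. if Suc m \<le> n then x ^ Suc m * g (n - Suc m) else 0) = (\<Sum>n\<in>{Suc m..<N}. x ^ Suc m * g (n - Suc m))"
    by (intro sum.mono_neutral_cong_right) auto
  also have "\<dots> = (\<Sum>n<N - Suc m. x ^ Suc m * g n)"
    by (rule sum.reindex_bij_witness[of _ "\<lambda>n. n + Suc m" "\<lambda>n. n - Suc m"]) auto
  also have "\<dots> \<le> (\<Sum>n<N. x ^ Suc m * g n)"
    using x g0 by (intro sum_mono2) auto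
  also have "\<dots> = x ^ Suc m * (\<Sum>n<N. g n)" by (simp add: sum_distrib_left)
  finally have "(\<Sum>n<N. g n) * (1 - x ^ Suc m) \<le> (\<Sum>n<N. real (card (bounded_partitions m n)) * x ^ n)"
    by (simp add: algebra_simps)
  also note Suc
  finally have "(\<Sum>n<N. g n) \<le> inverse (\<Prod>k<m. 1 - x ^ Suc k) / (1 - x ^ Suc m)"
    using lt by (subst pos_le_divide_eq) auto
  thus ?case by (simp add: g_def field_simps)
qed

lemma summable_bounded_partitions:
  fixes q :: complex
  assumes "norm q < 1"
  shows "summable (\<lambda>n. of_nat (card (bounded_partitions m n)) * q ^ n)"
proof (rule summable_norm_cancel)
  show "summable (\<lambda>n. norm (of_nat (card (bounded_partitions m n)) * q ^ n))"
    using bounded_partitions_partial_sums[of "norm q"] assms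
    by (intro bounded_imp_summable[where B = "inverse (\<Prod>k<m. 1 - norm q ^ Suc k)"])
       (auto simp: norm_mult norm_power lessThan_Suc_atMost[symmetric] simp del: sum.lessThan_Suc prod.lessThan_Suc)
qed

text \<open>The counting recursion says that the series for m + 1 minus the series for m is q^(m+1)
  times the former.\<close>

lemma suminf_bounded_partitions:
  fixes q :: complex
  assumes q: "norm q < 1"
  shows "(\<Sum>n. of_nat (card (bounded_partitions m n)) * q ^ n) * (\<Prod>k<m. 1 - q ^ Suc k) = 1"
proof (induction m)
  case 0
  have "(\<lambda>n. of_nat (card (bounded_partitions 0 n)) * q ^ n) sums (\<Sum>n\<in>{0}. of_nat (card (bounded_partitions 0 n)) * q ^ n)"
    by (rule sums_finite) (auto simp: bounded_partitions_0)
  thus ?case by (simp add: sums_iff bounded_partitions_0)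
next
  case (Suc m)
  define f where "f = (\<lambda>n. of_nat (card (bounded_partitions (Suc m) n)) * q ^ n)"
  define g where "g = (\<lambda>n. of_nat (card (bounded_partitions m n)) * q ^ n)"
  have f: "f sums suminf f" and g: "g sums suminf g"
    unfolding f_def g_def by (rule summable_sums[OF summable_bounded_partitions[OF q]])+
  have "f n - g n = (if Suc m \<le> n then q ^ Suc m * f (n - Suc m) else 0)" for n
  proof -
    have "q ^ n = q ^ Suc m * q ^ (n - Suc m)" if "Suc m \<le> n"
      using that by (metis le_add_diff_inverse power_add)
    thus ?thesis
      unfolding f_def g_def by (subst card_bounded_partitions_Suc) (auto simp: algebra_simps)
  qed
  hence "(\<lambda>n. if Suc m \<le> n then q ^ Suc m * f (n - Suc m) else 0) sums (suminf f - suminf g)"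
    using sums_diff[OF f g] by simp
  moreover have "(\<lambda>n. if Suc m \<le> n then q ^ Suc m * f (n - Suc m) else 0) sums (q ^ Suc m * suminf f)"
    using sums_mult[OF f, of "q ^ Suc m"] by (subst sums_iff_shift'[symmetric, where n = "Suc m"]) simp
  ultimately have "suminf f - suminf g = q ^ Suc m * suminf f"
    by (rule sums_unique2)
  hence "suminf g = suminf f * (1 - q ^ Suc m)" by (simp add: algebra_simps)
  with Suc show ?case by (simp add: f_def g_def mult_ac)
qed

text \<open>The first N partition numbers count partitions with parts at most N, so the partial sums
  are bounded by inverses of finite products, a sequence that converges as \<open>euler_prod\<close>
  does not vanish.\<close>

lemma summable_partition_number:
  fixes q :: complex
  assumes q: "norm q < 1"
  shows "summable (\<lambda>n. norm (of_nat (partition_number n) * q ^ n))"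
proof -
  define x where "x = norm q"
  have x: "0 \<le> x" "x < 1" using q by (auto simp: x_def)
  have "(\<lambda>m. inverse (norm (\<Prod>k<m. 1 - complex_of_real x ^ Suc k))) \<longlonglongrightarrow> inverse (norm (euler_prod (of_real x)))"
    using x by (intro tendsto_intros euler_prod_LIMSEQ) (auto simp: euler_prod_nonzero)
  hence "Bseq (\<lambda>m. inverse (norm (\<Prod>k<m. 1 - complex_of_real x ^ Suc k)))"
    by (intro convergent_imp_Bseq convergentI)
  then obtain B where B: "\<And>m. norm (inverse (norm (\<Prod>k<m. 1 - complex_of_real x ^ Suc k))) \<le> B"
    by (auto simp: Bseq_def)
  have "(\<Sum>n<N. real (partition_number n) * x ^ n) \<le> B" for N
  proof -
    have "(\<Sum>n<N. real (partition_number n) * x ^ n) = (\<Sum>n<N. real (card (bounded_partitions N n)) * x ^ n)"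
      by (intro sum.cong) (auto simp: partition_number_eq_card[of _ N])
    also have "\<dots> \<le> inverse (\<Prod>k<N. 1 - x ^ Suc k)"
      by (rule bounded_partitions_partial_sums[OF x])
    also have "\<dots> \<le> norm (inverse (norm (\<Prod>k<N. 1 - complex_of_real x ^ Suc k)))"
    proof -
      have "(\<Prod>k<N. 1 - complex_of_real x ^ Suc k) = of_real (\<Prod>k<N. 1 - x ^ Suc k)" by simp
      thus ?thesis by (simp only: norm_of_real norm_inverse real_norm_def abs_idempotent) (simp add: abs_inverse[symmetric] del: abs_inverse)
    qed
    also note B
    finally show ?thesis .
  qed
  hence "summable (\<lambda>n. real (partition_number n) * x ^ n)"
    using x by (intro bounded_imp_summable[where B = B]) (auto simp: lessThan_Suc_atMost[symmetric] simp del: sum.lessThan_Suc)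
  thus ?thesis by (simp add: norm_mult norm_power x_def)
qed

text \<open>Let m tend to infinity in \<open>suminf_bounded_partitions\<close>; the partition series
  itself dominates (Tannery).\<close>

lemma sums_partition_number:
  fixes q :: complex
  assumes q: "norm q < 1"
  shows "(\<lambda>n. of_nat (partition_number n) * q ^ n) sums (1 / euler_prod q)"
proof -
  have "(\<lambda>m. \<Sum>n. of_nat (card (bounded_partitions m n)) * q ^ n) \<longlonglongrightarrow> (\<Sum>n. of_nat (partition_number n) * q ^ n)"
  proof (rule tannerys_theorem[THEN conjunct2, THEN conjunct2])
    show "(\<lambda>m. of_nat (card (bounded_partitions m n)) * q ^ n) \<longlonglongrightarrow> of_nat (partition_number n) * q ^ n" for n
    proof (rule tendsto_eventually)
      show "\<forall>\<^sub>F m in sequentially. of_nat (card (bounded_partitions m n)) * q ^ n = of_nat (partition_number n) * q ^ n"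
        using eventually_ge_at_top[of n] by eventually_elim (simp add: partition_number_eq_card)
    qed
    show "\<forall>\<^sub>F (n, m) in at_top \<times>\<^sub>F sequentially. norm (of_nat (card (bounded_partitions m n)) * q ^ n)
            \<le> norm (of_nat (partition_number n) * q ^ n)"
      by (intro always_eventually)
         (auto simp: norm_mult card_bounded_partitions_le intro!: mult_right_mono)
  qed (use summable_partition_number[OF q] in auto)
  from tendsto_mult[OF this euler_prod_LIMSEQ[OF q]]
  have "(\<Sum>n. of_nat (partition_number n) * q ^ n) * euler_prod q = 1"
    by (simp only: suminf_bounded_partitions[OF q] LIMSEQ_const_iff)
  thus ?thesis
    using summable_norm_cancel[OF summable_partition_number[OF q]] euler_prod_nonzero[OF q]
    by (simp add: sums_iff field_simps)
qed

subsection \<open>Modular invariance on the unit disc\<close>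

text \<open>
  Translating into \<open>\<bar>Re z\<bar> \<le> 1/2\<close> and inverting at least doubles \<open>Im z\<close> as long as
  \<open>Im z < 1/2\<close>, so every orbit reaches the disc of radius \<open>exp (- pi)\<close>, where the maximum
  modulus of the function on the whole unit disc is therefore attained.
\<close>

lemma inversion_invariant_reduce:
  assumes inv: "\<And>z. Im z > 0 \<Longrightarrow> W (q_pow 1 (- 1 / z)) = W (q_pow 1 z)"
  assumes "Im z > 0" "1 / 2 \<le> Im z * 2 ^ n"
  shows "\<exists>z'. Im z' \<ge> 1 / 2 \<and> W (q_pow 1 z') = W (q_pow 1 z)"
  using assms(2,3)
proof (induction n arbitrary: z)
  case (Suc n)
  show ?case
  proof (cases "Im z \<ge> 1 / 2")
    case False
    define w where "w = z - of_int (round (Re z))"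
    have w: "Im w = Im z" "\<bar>Re w\<bar> \<le> 1 / 2" "w \<noteq> 0"
      using of_int_round_abs_le[of "Re z"] Suc.prems by (auto simp: w_def abs_minus_commute complex_eq_iff)
    have qw: "q_pow 1 w = q_pow 1 z"
    proof -
      have "2 * of_real pi * \<i> * w = 2 * of_real pi * \<i> * z - (2 * of_int (round (Re z)) * of_real pi) * \<i>"
        unfolding w_def by (simp add: algebra_simps)
      hence "q_pow 1 w = q_pow 1 z / exp ((2 * of_int (round (Re z)) * of_real pi) * \<i>)"
        unfolding q_pow_def by (simp flip: exp_diff)
      thus ?thesis using exp_integer_2pi[of "of_int (round (Re z))"] by simp
    qed
    \<comment> \<open>Both coordinates are at most 1/2 in absolute value, so the squared norm of w
      is at most 1/2, and inversion divides Im w by it.\<close>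
    have "(Re w)\<^sup>2 \<le> (1/2)\<^sup>2" "(Im w)\<^sup>2 \<le> (1/2)\<^sup>2"
      using w False Suc.prems by (intro abs_le_square_iff[THEN iffD1]; simp)+
    hence "(Re w)\<^sup>2 + (Im w)\<^sup>2 \<le> 1 / 2" by (simp add: power2_eq_square)
    moreover have "(Re w)\<^sup>2 + (Im w)\<^sup>2 > 0"
      using w Suc.prems by (simp add: add_nonneg_pos)
    moreover have "Im (- 1 / w) = Im w / ((Re w)\<^sup>2 + (Im w)\<^sup>2)"
      by (simp add: Im_divide)
    ultimately have "Im (- 1 / w) \<ge> Im w * 2"
      using w Suc.prems by (simp add: pos_le_divide_eq mult_left_le)
    hence im: "Im (- 1 / w) \<ge> Im z * 2" by (simp add: w)
    have "1 / 2 \<le> Im z * 2 * 2 ^ n" using Suc.prems by simp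
    also have "\<dots> \<le> Im (- 1 / w) * 2 ^ n" using im by (intro mult_right_mono) auto
    finally obtain z' where "Im z' \<ge> 1/2" "W (q_pow 1 z') = W (q_pow 1 (- 1 / w))"
      using Suc.IH[of "- 1 / w"] im Suc.prems by force
    thus ?thesis using inv[of w] w qw Suc.prems by auto
  qed auto
qed auto

lemma inversion_invariant_constant:
  assumes hol: "W holomorphic_on ball 0 1"
    and inv: "\<And>z. Im z > 0 \<Longrightarrow> W (q_pow 1 (- 1 / z)) = W (q_pow 1 z)"
    and q: "norm q < 1"
  shows "W q = W 0"
proof -
  \<comment> \<open>Im z >= 1/2 means norm q <= exp(-pi). The point q = 0, which no z reaches, lies
    in K by itself.\<close>
  define K where "K = cball (0 :: complex) (exp (- pi))"
  have "exp (- pi) < 1" by simp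
  hence K: "K \<subseteq> ball 0 1" unfolding K_def by (simp add: cball_subset_ball_iff)
  have red: "\<exists>q'\<in>K. W q' = W q" if q: "norm q < 1" for q
  proof (cases "q = 0")
    case True
    thus ?thesis by (intro bexI[of _ 0]) (auto simp: K_def)
  next
    case False
    with q obtain z where im: "Im z > 0" and qz: "q = q_pow 1 z" by (rule q_pow_1_surj)
    obtain n where "1 / 2 / Im z < 2 ^ n"
      using real_arch_pow[of 2 "1 / 2 / Im z"] by auto
    hence "1 / 2 \<le> Im z * 2 ^ n" using im by (simp add: field_simps)
    from inversion_invariant_reduce[OF inv im this]
    obtain z' where z': "Im z' \<ge> 1/2" "W (q_pow 1 z') = W (q_pow 1 z)" by blast
    have "q_pow 1 z' \<in> K" using z' by (simp add: K_def norm_q_pow)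
    thus ?thesis using z' qz by blast
  qed
  have "continuous_on K (\<lambda>q. norm (W q))"
    using holomorphic_on_imp_continuous_on[OF hol] K by (intro continuous_intros) (rule continuous_on_subset)
  then obtain x where x: "x \<in> K" "\<And>q. q \<in> K \<Longrightarrow> norm (W q) \<le> norm (W x)"
    using continuous_attains_sup[of K "\<lambda>q. norm (W q)"] by (auto simp: K_def)
  have "W constant_on ball 0 1"
  proof (rule maximum_modulus_principle[OF hol, of "ball 0 1" x])
    show "norm (W q) \<le> norm (W x)" if "q \<in> ball 0 1" for q
      using red[of q] x(2) that by force
  qed (use x K in auto)
  thus ?thesis using q unfolding constant_on_def by auto
qed

subsection \<open>Identification of the coefficients\<close>

lemma pos_cong_1_mod_24: "{n :: int. 0 < n \<and> [n = 1] (mod 24)} = range (\<lambda>k::nat. 24 * int k + 1)"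
proof (intro Set.equalityI subsetI)
  fix n :: int assume "n \<in> {n. 0 < n \<and> [n = 1] (mod 24)}"
  hence "n = 24 * int (nat (n div 24)) + 1" by (auto simp: cong_def) presburger
  thus "n \<in> range (\<lambda>k::nat. 24 * int k + 1)" by blast
qed (auto simp: cong_def)

lemma pos_cong_minus_1_mod_24: "{n :: int. 0 < n \<and> [n = -1] (mod 24)} = range (\<lambda>k::nat. 24 * int k + 23)"
proof (intro Set.equalityI subsetI)
  fix n :: int assume "n \<in> {n. 0 < n \<and> [n = -1] (mod 24)}"
  hence "n = 24 * int (nat (n div 24)) + 23" by (auto simp: cong_def) presburger
  thus "n \<in> range (\<lambda>k::nat. 24 * int k + 23)" by blast
qed (auto simp: cong_def)

lemma cong_23_mod_24:
  "{n :: int. -1 \<le> n \<and> [n = 23] (mod 24)} = insert (-1) (range (\<lambda>k::nat. 24 * int k + 23))"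
proof -
  have "{n :: int. -1 \<le> n \<and> [n = 23] (mod 24)} = insert (-1) {n. 0 < n \<and> [n = -1] (mod 24)}"
    by (auto simp: cong_def) presburger
  thus ?thesis by (simp only: pos_cong_minus_1_mod_24)
qed

lemma Im_moebius_pos:
  assumes "\<gamma> \<in> SL2Z" "z \<in> upper_half"
  shows "moebius \<gamma> z \<in> upper_half"
proof -
  define a b c d where "a = real_of_int (\<gamma>$1$1)" "b = real_of_int (\<gamma>$1$2)" "c = real_of_int (\<gamma>$2$1)" "d = real_of_int (\<gamma>$2$2)"
  note abcd = this
  have det: "a * d - b * c = 1"
    using assms(1) unfolding SL2Z_def abcd det_2 by (simp flip: of_int_mult of_int_diff)
  have y: "Im z > 0" using assms(2) by (simp add: upper_half_def)
  have w: "aut_factor \<gamma> z = Complex (c * Re z + d) (c * Im z)" "of_int (\<gamma>$1$1) * z + of_int (\<gamma>$1$2) = Complex (a * Re z + b) (a * Im z)"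
    by (simp_all add: aut_factor_def abcd complex_eq_iff)
  have "(c * Re z + d)\<^sup>2 + (c * Im z)\<^sup>2 \<noteq> 0"
  proof
    assume "(c * Re z + d)\<^sup>2 + (c * Im z)\<^sup>2 = 0"
    hence "c * Re z + d = 0" "c * Im z = 0" by (simp_all add: sum_power2_eq_zero_iff)
    with y have "c = 0" "d = 0" by auto
    with det show False by simp
  qed
  hence pos: "(c * Re z + d)\<^sup>2 + (c * Im z)\<^sup>2 > 0"
    by (simp add: less_le)
  have "Im (moebius \<gamma> z) = (a * Im z * (c * Re z + d) - (a * Re z + b) * (c * Im z)) / ((c * Re z + d)\<^sup>2 + (c * Im z)\<^sup>2)"
    unfolding moebius_def w by (simp add: Im_divide)
  also have "a * Im z * (c * Re z + d) - (a * Re z + b) * (c * Im z) = (a * d - b * c) * Im z"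
    by (simp add: algebra_simps)
  finally show ?thesis using det y pos by (simp add: upper_half_def)
qed

text \<open>\<open>P_series\<close> is compared with \<open>h1\<close> on the upper half plane only.
  Second derivatives agree by applying the first-order statement to the first derivatives, and the
  radius of analyticity is cut down to stay above the real axis.\<close>

lemma weak_harmonic_maass_cong:
  assumes f: "f \<in> weak_harmonic_maass k" and eq: "\<And>z. z \<in> upper_half \<Longrightarrow> g z = f z"
  shows "g \<in> weak_harmonic_maass k"
proof -
  have px: "partial_x F z = partial_x G z" if "z \<in> upper_half" "\<And>z. z \<in> upper_half \<Longrightarrow> F z = G z" for F G z
    unfolding partial_x_def
  proof (rule vector_derivative_cong_eq)
    show "\<forall>\<^sub>F t in nhds 0. t \<in> UNIV \<longrightarrow> F (z + of_real t) = G (z + of_real t)"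
      using that by (intro always_eventually) (auto simp: upper_half_def)
  qed auto
  have py: "partial_y F z = partial_y G z" if "z \<in> upper_half" "\<And>z. z \<in> upper_half \<Longrightarrow> F z = G z" for F G z
    unfolding partial_y_def
  proof (rule vector_derivative_cong_eq)
    have "\<forall>\<^sub>F t in nhds (0::real). t \<in> {- Im z<..}"
      using that by (intro eventually_nhds_in_open) (auto simp: upper_half_def)
    thus "\<forall>\<^sub>F t in nhds 0. t \<in> UNIV \<longrightarrow> F (z + \<i> * of_real t) = G (z + \<i> * of_real t)"
      by eventually_elim (use that in \<open>auto simp: upper_half_def\<close>)
  qed auto
  have lap: "laplacian k g z = laplacian k f z" if "z \<in> upper_half" for z
    unfolding laplacian_def
    using px[OF that, of g f] py[OF that, of g f] px[OF that, of "partial_x g" "partial_x f"] py[OF that, of "partial_y g" "partial_y f"]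
      px[of _ g f] py[of _ g f] eq by simp
  have "real_analytic g"
    unfolding real_analytic_def
  proof
    fix z assume z: "z \<in> upper_half"
    obtain r c where r: "r > 0" and c: "\<And>u v :: real. \<bar>u\<bar> < r \<Longrightarrow> \<bar>v\<bar> < r \<Longrightarrow>
        ((\<lambda>(l, m). c l m * of_real u ^ l * of_real v ^ m) has_sum f (z + Complex u v)) UNIV"
      using f z unfolding weak_harmonic_maass_def real_analytic_def by blast
    have "((\<lambda>(l, m). c l m * of_real u ^ l * of_real v ^ m) has_sum g (z + Complex u v)) UNIV"
      if "\<bar>u\<bar> < min r (Im z)" "\<bar>v\<bar> < min r (Im z)" for u v
    proof -
      have "z + Complex u v \<in> upper_half" using that by (auto simp: upper_half_def)
      thus ?thesis using c[of u v] that eq by simp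
    qed
    moreover have "min r (Im z) > 0" using r z by (simp add: upper_half_def)
    ultimately show "\<exists>r>0. \<exists>c. \<forall>u v :: real. \<bar>u\<bar> < r \<and> \<bar>v\<bar> < r \<longrightarrow>
        ((\<lambda>(l, m). c l m * of_real u ^ l * of_real v ^ m) has_sum g (z + Complex u v)) UNIV"
      by blast
  qed
  moreover have "has_maass_expansion k g a b = has_maass_expansion k f a b" for a b
    unfolding has_maass_expansion_def using eq by simp
  ultimately show ?thesis
    using f unfolding weak_harmonic_maass_def by (simp add: eq Im_moebius_pos lap)
qed

section \<open>The inversion matrix and the coefficients of h_1\<close>

definition S_matrix :: "int^2^2" where
  "S_matrix = vector [vector [0, -1], vector [1, 0]]"

lemma S_matrix_in_SL2Z: "S_matrix \<in> SL2Z"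
  by (simp add: SL2Z_def S_matrix_def det_2)

lemma aut_factor_S: "aut_factor S_matrix z = z"
  by (simp add: aut_factor_def S_matrix_def)

lemma moebius_S: "moebius S_matrix z = - 1 / z"
  by (simp add: moebius_def aut_factor_S) (simp add: S_matrix_def)

text \<open>The inversion law shows existence; evaluation at i, where eta does not vanish, shows
  uniqueness.\<close>

lemma eta_multiplier_S: "eta_multiplier S_matrix = 1 / \<i> powr (1/2)"
  unfolding eta_multiplier_def moebius_S aut_factor_S
proof (rule the_equality)
  show "\<forall>z\<in>upper_half. dedekind_eta (- 1 / z) = 1 / \<i> powr (1/2) * z powr (1/2) * dedekind_eta z"
    using dedekind_eta_inversion by (auto simp: upper_half_def)
  fix e assume "\<forall>z\<in>upper_half. dedekind_eta (- 1 / z) = e * z powr (1/2) * dedekind_eta z"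
  hence "dedekind_eta (- 1 / \<i>) = e * \<i> powr (1/2) * dedekind_eta \<i>"
    by (rule bspec) (simp add: upper_half_def)
  thus "e = 1 / \<i> powr (1/2)"
    using dedekind_eta_nonzero[of \<i>] by (simp add: field_simps)
qed

lemma norm_eta_multiplier_S: "norm (eta_multiplier S_matrix) = 1"
  by (simp add: eta_multiplier_S norm_divide norm_powr_real_powr')

lemma cnj_linear_unique:
  assumes "\<And>v. a * v + b * cnj v = c * v + d * cnj v"
  shows "b = d"
  using assms[of 1] assms[of \<i>] by (simp add: complex_eq_iff)


lemma powser_coeff_unique:
  fixes a b :: "nat \<Rightarrow> complex"
  assumes "\<And>q. norm q < 1 \<Longrightarrow> (\<lambda>n. a n * q ^ n) sums f q" "\<And>q. norm q < 1 \<Longrightarrow> (\<lambda>n. b n * q ^ n) sums f q"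
  shows "a n = b n"
proof (rule ccontr)
  assume neq: "a n \<noteq> b n"
  have sm: "(\<lambda>n. (a n - b n) * (q - 0) ^ n) sums 0" if "norm (q - 0) < 1" for q
    using sums_diff[OF assms(1)[of q] assms(2)[of q]] that by (simp add: algebra_simps)
  have "a 0 - b 0 = 0" using sm[of 0] by simp
  hence "n > 0" using neq by (cases n) auto
  \<comment> \<open>A nonzero coefficient would make the sum nonzero on a punctured disc. The sum is
    the zero function, so the conclusion obtained is 0 \<noteq> 0 there.\<close>
  obtain s where s: "0 < s" "\<And>z :: complex. z \<in> cball 0 s - {0} \<Longrightarrow> (0 :: complex) \<noteq> 0"
    by (rule powser_0_nonzero[of 1 0 "\<lambda>n. a n - b n" "\<lambda>_. 0" n]) (use sm neq \<open>n > 0\<close> in auto)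
  show False using s(1) s(2)[of "of_real s"] by simp
qed

lemma is_h1_coefficients:
  assumes h1: "is_h1 h pp pm"
  shows "pm (24 * int k + 23) = - of_nat (partition_number (Suc k)) * of_real ((24 * real k + 23) powr (3 / 2))"
proof -
  define N where "N = (\<lambda>k::nat. 24 * real k + 23)"
  define m where "m = (\<lambda>k::nat. pm (24 * int k + 23))"
  define \<epsilon> where "\<epsilon> = eta_multiplier S_matrix"
  have N: "N k \<ge> 1" for k by (simp add: N_def)
  define S where "S = (\<lambda>z. \<Sum>\<^sub>\<infinity>k. pp (24 * int k + 1) * q_pow (1 / 24 + real k) z)"
  \<comment> \<open>\<open>is_h1\<close> provides the two sums separately at each point; infinite
    sums turn them into functions that can be differentiated.\<close>
  define T where "T = (\<lambda>z. \<Sum>\<^sub>\<infinity>k. m k * \<beta> (N k * Im z) * q_pow (- N k / 24) z)"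
  have expansion: "((\<lambda>k. pp (24 * int k + 1) * q_pow (1 / 24 + real k) z) has_sum S z) UNIV"
    "((\<lambda>k. m k * \<beta> (N k * Im z) * q_pow (- N k / 24) z) has_sum T z) UNIV"
    "h z = S z + \<i> * (\<beta> (- Im z) * q_pow (1 / 24) z) + T z" if z: "Im z > 0" for z
  proof -
    obtain s t where
      s: "((\<lambda>n. pp n * q_pow (of_int n / 24) z) has_sum s) (range (\<lambda>k::nat. 24 * int k + 1))" and
      t: "((\<lambda>n. pm n * \<beta> (of_int n * Im z) * q_pow (- of_int n / 24) z) has_sum t) (range (\<lambda>k::nat. 24 * int k + 23))" and
      h: "h z = s + \<i> * \<beta> (- Im z) * q_pow (1 / 24) z + t"
      using h1 z unfolding is_h1_def pos_cong_1_mod_24 pos_cong_minus_1_mod_24 by (auto simp: upper_half_def)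
    have s': "((\<lambda>k. pp (24 * int k + 1) * q_pow (1 / 24 + real k) z) has_sum s) UNIV"
      using s by (subst (asm) has_sum_reindex) (auto simp: inj_on_def o_def add_divide_distrib add.commute)
    have t': "((\<lambda>k. m k * \<beta> (N k * Im z) * q_pow (- N k / 24) z) has_sum t) UNIV"
    proof -
      have "inj (\<lambda>k::nat. 24 * int k + 23)" by (auto simp: inj_on_def)
      moreover have "real_of_int (24 * int k + 23) = N k" for k by (simp add: N_def)
      ultimately show ?thesis using t by (simp only: has_sum_reindex o_def m_def)
    qed
    have "S z = s" "T z = t" using infsumI[OF s'] infsumI[OF t'] by (simp_all add: S_def T_def)
    thus "((\<lambda>k. pp (24 * int k + 1) * q_pow (1 / 24 + real k) z) has_sum S z) UNIV"
      "((\<lambda>k. m k * \<beta> (N k * Im z) * q_pow (- N k / 24) z) has_sum T z) UNIV"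
      "h z = S z + \<i> * (\<beta> (- Im z) * q_pow (1 / 24) z) + T z"
      using s' t' h by (simp_all add: mult.assoc)
  qed
  define H where "H = {z. Im z > 0}"
  have openH: "open H" unfolding H_def by (rule open_halfspace_Im_gt)
  obtain US where US: "US holomorphic_on ball 0 1" "\<And>z. Im z > 0 \<Longrightarrow> S z = q_pow (1 / 24) z * US (q_pow 1 z)"
    using holomorphic_q_series[of "\<lambda>k. pp (24 * int k + 1)" "1 / 24" S] has_sum_imp_sums[OF expansion(1)] by blast
  have q_hol: "q_pow r holomorphic_on A" for r A
    unfolding q_pow_def[abs_def] by (intro holomorphic_intros)
  have "(\<lambda>z. q_pow (1 / 24) z * US (q_pow 1 z)) holomorphic_on H"
    by (intro holomorphic_on_mult q_hol holomorphic_on_compose_gen[OF q_hol US(1), unfolded o_def])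
       (auto simp: H_def norm_q_pow_1_less)
  hence "S holomorphic_on H"
    by (rule holomorphic_transform) (auto simp: H_def US(2))
  hence S_der: "(S has_derivative (\<lambda>v. deriv S z * v)) (at z)" if "Im z > 0" for z
    using holomorphic_derivI[OF _ openH, of S z UNIV] that by (simp add: H_def has_field_derivative_def)
  have coeffs: "summable (\<lambda>k. norm (m k) * N k * x ^ k)" if "0 < x" "x < 1" for x
    unfolding N_def
  proof (rule summable_coeffs[OF _ that])
    fix z :: complex assume z: "Im z > 0"
    have "(\<lambda>k. m k * \<beta> (N k * Im z) * q_pow (- N k / 24) z) summable_on UNIV"
      using expansion(2)[OF z] by (auto simp: summable_on_def)
    hence "(\<lambda>k. norm (m k * \<beta> (N k * Im z) * q_pow (- N k / 24) z)) summable_on UNIV"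
      by (simp only: summable_on_iff_abs_summable_on_complex)
    thus "summable (\<lambda>k. norm (m k * \<beta> ((24 * real k + 23) * Im z) * q_pow (- (24 * real k + 23) / 24) z))"
      unfolding N_def by (rule summable_on_imp_summable)
  qed
  \<comment> \<open>The q-coefficients of \<open>g\<close>. The value 1 comes from the term i
    \<beta>(-y) q^(1/24), and the index is shifted because N j / 24 = (j + 1) - 1/24. The conjugate
    appears because the derivative of \<open>h\<close> involves the conjugate of
    \<open>g\<close>.\<close>
  define d where "d = (\<lambda>k. case k of 0 \<Rightarrow> 1 | Suc j \<Rightarrow> - cnj (m j) * of_real (N j powr (- 3 / 2)))"
  have d0: "d 0 = 1" and dS: "d (Suc j) = - cnj (m j) * of_real (N j powr (- 3 / 2))" for j
    by (simp_all add: d_def)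
  have d_summable: "summable (\<lambda>k. d k * q ^ k)" if q: "norm q < 1" for q
  proof (cases "q = 0")
    case False
    have "summable (\<lambda>k. norm (m k) * N k * norm q ^ k)"
      using q False by (intro coeffs) auto
    moreover have "norm (d (Suc k) * q ^ Suc k) \<le> norm (m k) * N k * norm q ^ k" for k
    proof -
      have "N k powr (- 3 / 2) \<le> N k powr 1" using N[of k] by (intro powr_mono) auto
      also have "\<dots> = N k" using N[of k] by simp
      finally have "norm (m k) * N k powr (- 3 / 2) * norm q ^ Suc k \<le> norm (m k) * N k * norm q ^ k"
        using q N[of k] by (intro mult_mono mult_nonneg_nonneg power_decreasing) auto
      thus ?thesis by (simp add: dS norm_mult norm_power)
    qed
    ultimately have "summable (\<lambda>k. d (Suc k) * q ^ Suc k)"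
      by (rule summable_comparison_test')
    thus ?thesis by (subst (asm) summable_Suc_iff)
  qed (auto intro: sums_summable powser_sums_zero)
  define U where "U = (\<lambda>q. \<Sum>k. d k * q ^ k)"
  have U_hol: "U holomorphic_on ball 0 1"
    unfolding U_def by (rule holomorphic_powser_ball[OF d_summable])
  have U0: "U 0 = 1" by (simp add: U_def d0)
  define g where "g = (\<lambda>z. q_pow (- 1 / 24) z * U (q_pow 1 z))"
  \<comment> \<open>The factor shared by all terms of the derivative with respect to
    \<open>cnj z\<close>.\<close>
  define K where "K = (\<lambda>z. \<i> / 2 * of_real ((pi / 6) powr (- 3 / 2) * Im z powr (- 5 / 2)))"
  have h_der: "\<exists>A. (h has_derivative (\<lambda>v. A * v + K z * cnj (g z) * cnj v)) (at z)" if z: "Im z > 0" for z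
  proof -
    define B where "B = (\<lambda>k. m k * (\<i> / 2 * of_real (N k) * \<beta>_deriv (N k * Im z) * q_pow (- N k / 24) z))"
    have TT: "summable B" "\<exists>A. (T has_derivative (\<lambda>v. A * v + (\<Sum>k. B k) * cnj v)) (at z)"
      unfolding B_def N_def
      by (rule nonholomorphic_part_has_derivative[of m T z];
          use has_sum_imp_sums[OF expansion(2)] coeffs z in \<open>simp add: N_def\<close>)+
    obtain A1 where T_der: "(T has_derivative (\<lambda>v. A1 * v + (\<Sum>k. B k) * cnj v)) (at z)"
      using TT(2) by blast
    define B1 where "B1 = \<i> / 2 * of_real (- 1) * \<beta>_deriv (- 1 * Im z) * q_pow (- (- 1) / 24) z"
    have minus_one_nonzero: "- 1 \<noteq> (0 :: real)" by simp
    obtain A2 where "((\<lambda>z. \<beta> (- 1 * Im z) * q_pow (- (- 1) / 24) z) has_derivative (\<lambda>v. A2 * v + B1 * cnj v)) (at z)"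
      using \<beta>_q_pow_has_derivative[OF minus_one_nonzero z] unfolding B1_def by blast
    hence pole_der: "((\<lambda>z. \<i> * (\<beta> (- Im z) * q_pow (1 / 24) z)) has_derivative (\<lambda>v. \<i> * (A2 * v + B1 * cnj v))) (at z)"
      by (intro has_derivative_mult_right) simp
    have "((\<lambda>z. S z + \<i> * (\<beta> (- Im z) * q_pow (1 / 24) z) + T z) has_derivative
        (\<lambda>v. deriv S z * v + \<i> * (A2 * v + B1 * cnj v) + (A1 * v + (\<Sum>k. B k) * cnj v))) (at z)"
      by (intro has_derivative_add S_der z pole_der T_der)
    hence "(h has_derivative
        (\<lambda>v. deriv S z * v + \<i> * (A2 * v + B1 * cnj v) + (A1 * v + (\<Sum>k. B k) * cnj v))) (at z)"
      by (rule has_derivative_transform_within_open[OF _ openH]) (use z expansion(3) in \<open>auto simp: H_def\<close>)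
    moreover have "\<i> * B1 + (\<Sum>k. B k) = K z * cnj (g z)"
    proof -
      have "(\<lambda>k. q_pow (- 1 / 24) z * (d k * q_pow 1 z ^ k)) sums g z"
        unfolding g_def U_def using d_summable[of "q_pow 1 z"] norm_q_pow_1_less[OF z]
        by (intro sums_mult summable_sums) auto
      hence "(\<lambda>k. q_pow (- 1 / 24) z * (d (Suc k) * q_pow 1 z ^ Suc k)) sums (g z - q_pow (- 1 / 24) z)"
        by (subst sums_Suc_iff) (simp add: d0)
      hence "(\<lambda>k. K z * cnj (q_pow (- 1 / 24) z * (d (Suc k) * q_pow 1 z ^ Suc k))) sums (K z * cnj (g z - q_pow (- 1 / 24) z))"
        by (intro sums_mult) (simp only: sums_cnj)
      moreover have "K z * cnj (q_pow (- 1 / 24) z * (d (Suc k) * q_pow 1 z ^ Suc k)) = B k" for k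
      proof -
        have "q_pow (- 1 / 24) z * q_pow 1 z ^ Suc k = q_pow (N k / 24) z"
          unfolding q_pow_eq_power[symmetric] q_pow_add[symmetric] by (simp add: N_def add_divide_distrib add.commute)
        hence e1: "q_pow (- 1 / 24) z * (d (Suc k) * q_pow 1 z ^ Suc k) = d (Suc k) * q_pow (N k / 24) z"
          by (simp only: mult.left_commute)
        have e2: "B k = m k * (- \<i> / 2 * of_real ((pi / 6) powr (- 3 / 2) * Im z powr (- 5 / 2)) * of_real (N k powr (- 3 / 2)) * cnj (q_pow (N k / 24) z))"
          unfolding B_def by (subst \<beta>_deriv_q_pow_pos) (use N[of k] z in auto)
        show ?thesis unfolding e1 unfolding e2 K_def dS by (simp add: mult_ac)
      qed
      ultimately have "(\<Sum>k. B k) = K z * cnj (g z - q_pow (- 1 / 24) z)"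
        by (simp add: sums_iff)
      moreover have "\<i> * B1 = K z * cnj (q_pow (- 1 / 24) z)"
        unfolding B1_def K_def by (subst \<beta>_deriv_q_pow_minus_1[OF z]) (simp add: mult_ac)
      ultimately show ?thesis by (simp add: algebra_simps)
    qed
    moreover have "deriv S z * v + \<i> * (A2 * v + B1 * cnj v) + (A1 * v + (\<Sum>k. B k) * cnj v) =
        (deriv S z + \<i> * A2 + A1) * v + (\<i> * B1 + (\<Sum>k. B k)) * cnj v" for v
      by (simp add: algebra_simps)
    ultimately show ?thesis by auto
  qed
  have g_inv: "z powr (1 / 2) * g (- 1 / z) = cnj \<epsilon> * g z" if z: "Im z > 0" for z
  proof -
    have z0: "z \<noteq> 0" "z \<notin> \<real>\<^sub>\<le>\<^sub>0" using z by (auto simp: complex_nonpos_Reals_iff)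
    have Iz: "Im (- 1 / w) = Im w / (norm w)\<^sup>2" for w
      by (simp add: Im_divide cmod_power2)
    have z': "Im (- 1 / z) > 0" unfolding Iz using z z0 by simp
    have law: "h (- 1 / w) = \<epsilon> * w powr (5 / 2) * h w" if "w \<in> H" for w
    proof -
      have "h (moebius S_matrix w) = eta_multiplier S_matrix * aut_factor S_matrix w powr of_real (5 / 2) * h w"
        using h1 S_matrix_in_SL2Z that unfolding is_h1_def weak_harmonic_maass_def by (auto simp: upper_half_def H_def)
      thus ?thesis by (simp add: moebius_S aut_factor_S \<epsilon>_def)
    qed
    \<comment> \<open>The law is differentiated on both sides, by the chain rule and by the product
      rule. The maps -1/w and w^(5/2) are holomorphic, so the \<open>cnj v\<close> parts involve no
      derivative of w^(5/2).\<close>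
    obtain A1 where A1: "(h has_derivative (\<lambda>v. A1 * v + K (- 1 / z) * cnj (g (- 1 / z)) * cnj v)) (at (- 1 / z))"
      using h_der[OF z'] by blast
    have "((\<lambda>w. - 1 / w) has_field_derivative 1 / z\<^sup>2) (at z)"
      using z0 by (auto intro!: derivative_eq_intros simp: power2_eq_square)
    hence "((\<lambda>w. - 1 / w) has_derivative (\<lambda>v. 1 / z\<^sup>2 * v)) (at z)"
      by (simp only: has_field_derivative_def)
    from has_derivative_compose[OF this A1]
    have L: "((\<lambda>w. h (- 1 / w)) has_derivative
        (\<lambda>v. A1 * (1 / z\<^sup>2 * v) + K (- 1 / z) * cnj (g (- 1 / z)) * cnj (1 / z\<^sup>2 * v))) (at z)" .
    obtain A2 where A2: "(h has_derivative (\<lambda>v. A2 * v + K z * cnj (g z) * cnj v)) (at z)"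
      using h_der[OF z] by blast
    have "((\<lambda>w. \<epsilon> * w powr (5 / 2)) has_field_derivative \<epsilon> * (5 / 2 * z powr (5 / 2 - 1))) (at z)"
      using z0 by (intro DERIV_cmult has_field_derivative_powr)
    hence "((\<lambda>w. \<epsilon> * w powr (5 / 2)) has_derivative (\<lambda>v. \<epsilon> * (5 / 2 * z powr (5 / 2 - 1)) * v)) (at z)"
      by (simp only: has_field_derivative_def)
    from has_derivative_mult[OF this A2]
    have "((\<lambda>w. \<epsilon> * w powr (5 / 2) * h w) has_derivative
        (\<lambda>v. \<epsilon> * z powr (5 / 2) * (A2 * v + K z * cnj (g z) * cnj v) + \<epsilon> * (5 / 2 * z powr (5 / 2 - 1)) * v * h z)) (at z)" .
    hence "((\<lambda>w. h (- 1 / w)) has_derivative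
        (\<lambda>v. \<epsilon> * z powr (5 / 2) * (A2 * v + K z * cnj (g z) * cnj v) + \<epsilon> * (5 / 2 * z powr (5 / 2 - 1)) * v * h z)) (at z)"
      by (rule has_derivative_transform_within_open[OF _ openH]) (use z law in \<open>auto simp: H_def\<close>)
    from has_derivative_unique[OF L this]
    have eq: "A1 * (1 / z\<^sup>2 * v) + K (- 1 / z) * cnj (g (- 1 / z)) * cnj (1 / z\<^sup>2 * v) =
        \<epsilon> * z powr (5 / 2) * (A2 * v + K z * cnj (g z) * cnj v) + \<epsilon> * (5 / 2 * z powr (5 / 2 - 1)) * v * h z" for v
      by (rule fun_cong)
    have B_eq: "K (- 1 / z) * cnj (g (- 1 / z)) * cnj (1 / z\<^sup>2) = \<epsilon> * z powr (5 / 2) * (K z * cnj (g z))"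
    proof (rule cnj_linear_unique)
      fix v
      show "A1 * (1 / z\<^sup>2) * v + K (- 1 / z) * cnj (g (- 1 / z)) * cnj (1 / z\<^sup>2) * cnj v =
          (\<epsilon> * z powr (5 / 2) * A2 + \<epsilon> * (5 / 2 * z powr (5 / 2 - 1)) * h z) * v + \<epsilon> * z powr (5 / 2) * (K z * cnj (g z)) * cnj v"
        using eq[of v] unfolding complex_cnj_mult by (simp only: algebra_simps)
    qed
    \<comment> \<open>Im (-1/z) is Im z divided by the squared norm of z, so its power -5/2 gains
      the fifth power of the norm.\<close>
    have K': "K (- 1 / z) = K z * of_real (norm z ^ 5)"
    proof -
      have "(Im z / (norm z)\<^sup>2) powr (- 5 / 2) = Im z powr (- 5 / 2) / ((norm z)\<^sup>2) powr (- 5 / 2)"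
        by (rule powr_divide)
      also have "((norm z)\<^sup>2) powr (- 5 / 2) = inverse (norm z ^ 5)"
      proof -
        have "((norm z)\<^sup>2) powr (- 5 / 2) = (norm z powr 2) powr (- 5 / 2)" by simp
        also have "\<dots> = inverse (norm z powr 5)" unfolding powr_powr by (simp add: powr_minus)
        also have "norm z powr 5 = norm z ^ 5" by simp
        finally show ?thesis .
      qed
      finally have "(Im z / (norm z)\<^sup>2) powr (- 5 / 2) = Im z powr (- 5 / 2) * norm z ^ 5"
        by (simp only: divide_inverse inverse_inverse_eq)
      thus ?thesis unfolding K_def Iz by simp
    qed
    have "K z \<noteq> 0" using z by (simp add: K_def)
    have "K z * (of_real (norm z ^ 5) * cnj (g (- 1 / z)) / cnj z ^ 2) = K (- 1 / z) * cnj (g (- 1 / z)) * cnj (1 / z\<^sup>2)"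
      unfolding K' by simp
    also note B_eq
    also have "\<epsilon> * z powr (5 / 2) * (K z * cnj (g z)) = K z * (\<epsilon> * z powr (5 / 2) * cnj (g z))"
      by (rule mult.left_commute)
    finally have "K z * (of_real (norm z ^ 5) * cnj (g (- 1 / z)) / cnj z ^ 2) = K z * (\<epsilon> * z powr (5 / 2) * cnj (g z))" .
    with \<open>K z \<noteq> 0\<close> have 1: "of_real (norm z ^ 5) * cnj (g (- 1 / z)) / cnj z ^ 2 = \<epsilon> * z powr (5 / 2) * cnj (g z)"
      by (simp only: mult_cancel_left simp_thms)
    \<comment> \<open>Every factor is a power of this root: z = s^2, z^(5/2) = s^5 and norm z = s *
      cnj s. Cancelling s^5 (cnj s)^4 leaves a law of weight -1/2.\<close>
    define s where "s = z powr (1 / 2)"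
    have s0: "s \<noteq> 0" using z0 by (simp add: s_def)
    have s2: "z = s\<^sup>2" using z0 by (simp add: s_def power2_eq_square flip: powr_add)
    have s5: "z powr (5 / 2) = s ^ 5"
      using z0 by (simp add: s_def powr_power)
    have "s * cnj s = of_real (norm z)"
      by (simp add: complex_norm_square[symmetric] s2 norm_power)
    hence sn: "of_real (norm z ^ 5) = (s * cnj s) ^ 5" by simp
    have cz: "cnj z = (cnj s)\<^sup>2" by (simp add: s2)
    have "of_real (norm z ^ 5) * cnj (g (- 1 / z)) = \<epsilon> * z powr (5 / 2) * cnj (g z) * cnj z ^ 2"
      using 1 z0 by (subst (asm) nonzero_divide_eq_eq) auto
    hence "(s * cnj s) ^ 5 * cnj (g (- 1 / z)) = \<epsilon> * s ^ 5 * cnj (g z) * ((cnj s)\<^sup>2)\<^sup>2"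
      unfolding sn s5 cz .
    moreover have "(a * b) ^ 5 * c = a ^ 5 * b ^ 4 * (b * c)" for a b c :: complex
      by (simp add: power_mult_distrib eval_nat_numeral mult_ac)
    moreover have "e * a ^ 5 * c * (b\<^sup>2)\<^sup>2 = a ^ 5 * b ^ 4 * (e * c)" for a b c e :: complex
      by (simp add: eval_nat_numeral mult_ac)
    ultimately have "s ^ 5 * cnj s ^ 4 * (cnj s * cnj (g (- 1 / z))) = s ^ 5 * cnj s ^ 4 * (\<epsilon> * cnj (g z))"
      by metis
    hence "cnj s * cnj (g (- 1 / z)) = \<epsilon> * cnj (g z)" using s0 by simp
    hence "cnj (cnj s * cnj (g (- 1 / z))) = cnj (\<epsilon> * cnj (g z))" by simp
    thus ?thesis by (simp add: s_def)
  qed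
  define W where "W = (\<lambda>q. U q * euler_prod q)"
  have g_eta: "W (q_pow 1 z) = g z * dedekind_eta z" for z
    by (simp add: W_def g_def dedekind_eta_altdef mult_ac) (simp add: q_pow_def flip: exp_add)
  have "W q = W 0" if "norm q < 1" for q
  proof (rule inversion_invariant_constant[OF _ _ that])
    show "W holomorphic_on ball 0 1"
      unfolding W_def by (intro holomorphic_on_mult U_hol holomorphic_euler_prod)
    fix z :: complex assume z: "Im z > 0"
    have "dedekind_eta (- 1 / z) = \<epsilon> * z powr (1 / 2) * dedekind_eta z"
      using dedekind_eta_inversion[OF z] by (simp add: \<epsilon>_def eta_multiplier_S)
    hence "W (q_pow 1 (- 1 / z)) = \<epsilon> * (z powr (1 / 2) * g (- 1 / z)) * dedekind_eta z"
      by (simp add: g_eta)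
    also have "\<dots> = (\<epsilon> * cnj \<epsilon>) * (g z * dedekind_eta z)"
      unfolding g_inv[OF z] by simp
    also have "\<epsilon> * cnj \<epsilon> = 1"
      unfolding complex_norm_square[symmetric] \<epsilon>_def norm_eta_multiplier_S by simp
    finally show "W (q_pow 1 (- 1 / z)) = W (q_pow 1 z)" by (simp add: g_eta)
  qed
  \<comment> \<open>The constant value is W 0 = U 0 = 1.\<close>
  hence "U q = 1 / euler_prod q" if "norm q < 1" for q
    using that U0 euler_prod_nonzero[OF that] by (simp add: W_def field_simps)
  hence U_sums: "(\<lambda>k. d k * q ^ k) sums (1 / euler_prod q)" if "norm q < 1" for q
    using summable_sums[OF d_summable[OF that]] that by (simp add: U_def)
  have "d (Suc k) = of_nat (partition_number (Suc k))"
    by (rule powser_coeff_unique[OF U_sums sums_partition_number])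
  hence "cnj (- cnj (m k) * of_real (N k powr (- 3 / 2))) = cnj (of_nat (partition_number (Suc k)))"
    unfolding dS by (rule arg_cong)
  hence "- m k * of_real (N k powr (- 3 / 2)) = of_nat (partition_number (Suc k))"
    by simp
  hence "- m k * of_real (N k powr (- 3 / 2) * N k powr (3 / 2)) = of_nat (partition_number (Suc k)) * of_real (N k powr (3 / 2))"
    by (simp add: mult.assoc[symmetric])
  also have "N k powr (- 3 / 2) * N k powr (3 / 2) = 1"
    unfolding powr_add[symmetric] using N[of k] by simp
  finally have "- m k = of_nat (partition_number (Suc k)) * of_real (N k powr (3 / 2))" by simp
  hence "m k = - (of_nat (partition_number (Suc k)) * of_real (N k powr (3 / 2)))"
    by (metis minus_minus)
  thus ?thesis by (simp add: m_def N_def)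
qed

theorem corollary2:
  fixes h1 :: "complex \<Rightarrow> complex" and p1_plus p1_minus :: "int \<Rightarrow> complex"
  assumes "is_h1 h1 p1_plus p1_minus"
  shows "P_series p1_plus \<in> weak_harmonic_maass (5 / 2)"
proof (rule weak_harmonic_maass_cong)
  show "h1 \<in> weak_harmonic_maass (5 / 2)" using assms by (simp add: is_h1_def)
  fix z assume z: "z \<in> upper_half"
  define t where "t = (\<lambda>n. of_nat (partition_number (nat ((n + 1) div 24))) * of_int n powr (3 / 2)
          * \<beta> (of_int n * Im z) * q_pow (- of_int n / 24) z)"
  let ?R = "range (\<lambda>k::nat. 24 * int k + 23)"
  obtain S T where S: "((\<lambda>n. p1_plus n * q_pow (of_int n / 24) z) has_sum S) {n. 0 < n \<and> [n = 1] (mod 24)}" and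
      T: "((\<lambda>n. p1_minus n * \<beta> (of_int n * Im z) * q_pow (- of_int n / 24) z) has_sum T) ?R" and
      h: "h1 z = S + \<i> * \<beta> (- Im z) * q_pow (1 / 24) z + T"
    using assms z unfolding is_h1_def pos_cong_minus_1_mod_24 by blast
  have "t n = - (p1_minus n * \<beta> (of_int n * Im z) * q_pow (- of_int n / 24) z)" if "n \<in> ?R" for n
  proof -
    obtain k :: nat where n: "n = 24 * int k + 23" using \<open>n \<in> ?R\<close> by blast
    have "nat ((n + 1) div 24) = Suc k" by (simp add: n)
    moreover have "complex_of_int n powr (3 / 2) = of_real ((24 * real k + 23) powr (3 / 2))"
      using powr_of_real[of "24 * real k + 23" "3 / 2"] by (simp add: n)
    ultimately show ?thesis
      using is_h1_coefficients[OF assms, of k] by (simp add: t_def flip: n)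
  qed
  hence "(t has_sum - T) ?R"
    using has_sum_cmult_right[OF T, of "-1"] by (subst has_sum_cong) auto
  hence "(t has_sum (t (- 1) + - T)) (insert (- 1) ?R)"
    by (intro has_sum_insert) auto
  \<comment> \<open>The index -1 carries p(0) = 1 and (-1)^(3/2) = -i; with the minus sign in front
    of the second sum it reproduces the term i \<beta>(-y) q^(1/24) of \<open>h1\<close>.\<close>
  moreover have "t (- 1) = - \<i> * \<beta> (- Im z) * q_pow (1 / 24) z"
  proof -
    have "partition_number 0 = 1"
      by (simp add: partition_number_eq_card[of 0 0] bounded_partitions_0)
    moreover have "(- 1 :: complex) powr (3 / 2) = - \<i>"
    proof -
      have "(- 1 :: complex) powr (3 / 2) = cis (pi + pi / 2)"
        by (simp add: powr_def cis_conv_exp algebra_simps)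
      also have "\<dots> = cis pi * cis (pi / 2)" unfolding cis_mult ..
      also have "\<dots> = - \<i>" by simp
      finally show ?thesis .
    qed
    ultimately show ?thesis by (simp add: t_def)
  qed
  ultimately have "infsum t {n. -1 \<le> n \<and> [n = 23] (mod 24)} = - \<i> * \<beta> (- Im z) * q_pow (1 / 24) z - T"
    unfolding cong_23_mod_24 by (simp add: infsumI)
  thus "P_series p1_plus z = h1 z"
    unfolding P_series_def t_def[symmetric] infsumI[OF S] h by simp
qed

end
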